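(* Let $(w_k)_{k\ge 0}$ be a sequence of positive real numbers and assume that there exists some $\alpha\in[0,1/2)$ such that $w_k\asymp (k+1)^\alpha$, i.e. $w_k/(k+1)^\alpha$ is bounded above and below by positive constants. Then the vertex reinforced random walk $(X_n)_{n\ge 0}$ on $\mathbb{Z}$ with weight $(w_k)_{k\ge0}$ is either almost surely recurrent or almost surely transient. That is, the set $R'$ of sites of $\mathbb{Z}$ visited infinitely often by $X$ is either almost surely equal to $\mathbb{Z}$ or almost surely empty.
   Context: The vertex reinforced random walk (VRRW) on $\mathbb{Z}$ with weight $(w_k)_{k\ge0}$ is the process $(X_n)_{n\ge0}$ with $X_0=0$ and, for all $n\ge 0$, on the event $\{X_n=x\}$, $$\mathbb{P}(X_{n+1}=X_n\pm1\mid \mathcal{F}_n)=\frac{w_{Z_n(x\pm1)}}{w_{Z_n(x-1)}+w_{Z_n(x+1)}},$$ where $(\mathcal{F}_n)$ is the natural filtration of $X$ and $Z_n(y)=\#\{m\le n: X_m=y\}$ is the local time at $y$ at time $n$. The walk is called recurrent if every site is visited infinitely often and transient if every site is visited only finitely many times. *)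

theory Defs
  imports "HOL-Probability.Probability"
begin

definition loc_time :: "(nat \<Rightarrow> int) \<Rightarrow> nat \<Rightarrow> int \<Rightarrow> nat" where
  "loc_time f n y = card {m. m \<le> n \<and> f m = y}"

definition vrrw_step :: "(nat \<Rightarrow> real) \<Rightarrow> (nat \<Rightarrow> int) \<Rightarrow> nat \<Rightarrow> real" where
  "vrrw_step w f n =
     (let x = f n;
          den = w (loc_time f n (x - 1)) + w (loc_time f n (x + 1))
      in if f (Suc n) = x + 1 then w (loc_time f n (x + 1)) / den
         else if f (Suc n) = x - 1 then w (loc_time f n (x - 1)) / den
         else 0)"

definition vrrw_path_prob :: "(nat \<Rightarrow> real) \<Rightarrow> (nat \<Rightarrow> int) \<Rightarrow> nat \<Rightarrow> real" where
  "vrrw_path_prob w f n = (if f 0 = 0 then 1 else 0) * (\<Prod>k<n. vrrw_step w f k)"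

definition is_vrrw :: "'a measure \<Rightarrow> (nat \<Rightarrow> 'a \<Rightarrow> int) \<Rightarrow> (nat \<Rightarrow> real) \<Rightarrow> bool" where
  "is_vrrw M X w \<longleftrightarrow> prob_space M \<and>
     (\<forall>n. X n \<in> measurable M (count_space UNIV)) \<and>
     (\<forall>f n. measure M {\<omega> \<in> space M. \<forall>i\<le>n. X i \<omega> = f i} = vrrw_path_prob w f n)"

end

theory Submission
  imports Defs
begin

text \<open>
  Let \<open>T\<^sub>n\<close> be the hitting time of \<open>n\<close>, and weight each jump \<open>x \<rightarrow> x \<plusminus> 1\<close> by
  \<open>1 / w (local time at x \<plusminus> 1)\<close>; then the weighted numbers of jumps to the right and to the left from \<open>x\<close>
  have the same expectation, also when stopped at \<open>T\<^sub>n\<close>. Comparing weighted and unweighted numbers of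
  crossings, the quantity \<open>e\<^sub>i = E[U\<^sub>i powr (1 - \<alpha>)]\<close>, with \<open>U\<^sub>i\<close> the number of jumps
  \<open>n - 1 - i \<rightarrow> n - i\<close> before \<open>T\<^sub>n\<close>, satisfies \<open>e\<^sub>i \<le> \<Lambda> e\<^bsub>i-1\<^esub> + \<delta> e\<^bsub>i+1\<^esub> + 2\<close>, where \<open>\<delta> \<Lambda>\<close> can be
  made arbitrarily small exactly because \<open>\<alpha> < 1/2\<close>. Hence \<open>e\<^sub>i\<close> is bounded uniformly in \<open>n\<close>.

  So every site below \<open>n\<close> is visited finitely often before \<open>T\<^sub>n\<close>, even if \<open>T\<^sub>n = \<infinity>\<close>: a walk visiting some
  site infinitely often hits every site, hence visits every site infinitely often. Moreover the
  local time at \<open>n - 1\<close> at time \<open>T\<^sub>n\<close> is tight in \<open>n\<close>. If the walk escapes to \<open>+\<infinity>\<close> with positive probability,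
  then after \<open>T\<^sub>n\<close>, when the environment to the right is fresh, it escapes with a probability bounded
  below in terms of that local time. As recurrence is approximated by events depending on finitely
  many steps, it has probability zero.
\<close>

section \<open>Finite paths and their crossings\<close>

text \<open>Paths are lists with the most recent position first, so \<open>count_list\<close> is the local time.\<close>
definition step_prob :: "(nat \<Rightarrow> real) \<Rightarrow> int list \<Rightarrow> int \<Rightarrow> real" where
  "step_prob w h y =
     (let x = hd h; den = w (count_list h (x - 1)) + w (count_list h (x + 1))
      in if y = x + 1 then w (count_list h (x + 1)) / den
         else if y = x - 1 then w (count_list h (x - 1)) / den
         else 0)"

fun path_wt :: "(nat \<Rightarrow> real) \<Rightarrow> int list \<Rightarrow> real" where
  "path_wt w [] = 0"
| "path_wt w [x] = (if x = 0 then 1 else 0)"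
| "path_wt w (y # x # h) = step_prob w (x # h) y * path_wt w (x # h)"

fun paths :: "nat \<Rightarrow> int list set" where
  "paths 0 = {[0]}"
| "paths (Suc t) = (\<lambda>h. (hd h + 1) # h) ` paths t \<union> (\<lambda>h. (hd h - 1) # h) ` paths t"

fun up :: "int \<Rightarrow> int list \<Rightarrow> nat" where
  "up x (y # z # h) = up x (z # h) + (if z = x \<and> y = x + 1 then 1 else 0)"
| "up x _ = 0"

fun down :: "int \<Rightarrow> int list \<Rightarrow> nat" where
  "down x (y # z # h) = down x (z # h) + (if z = x \<and> y = x - 1 then 1 else 0)"
| "down x _ = 0"

text \<open>The weight is taken at the local time before the jump, matching the transition
  probability that it has to cancel.\<close>

fun Yup :: "(nat \<Rightarrow> real) \<Rightarrow> int \<Rightarrow> int list \<Rightarrow> real" where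
  "Yup w x (y # z # h) = Yup w x (z # h)
     + (if z = x \<and> y = x + 1 then 1 / w (count_list (z # h) (x + 1)) else 0)"
| "Yup w x _ = 0"

fun Ydown :: "(nat \<Rightarrow> real) \<Rightarrow> int \<Rightarrow> int list \<Rightarrow> real" where
  "Ydown w x (y # z # h) = Ydown w x (z # h)
     + (if z = x \<and> y = x - 1 then 1 / w (count_list (z # h) (x - 1)) else 0)"
| "Ydown w x _ = 0"

text \<open>The path stopped at its first visit to \<open>n\<close>.\<close>
fun trunc :: "int \<Rightarrow> int list \<Rightarrow> int list" where
  "trunc n [] = []"
| "trunc n (y # h) = (if n \<in> set h then trunc n h else y # h)"

lemma paths_nonempty: "h \<in> paths t \<Longrightarrow> h \<noteq> []"
  by (cases t) auto

lemma paths_length: "h \<in> paths t \<Longrightarrow> length h = Suc t"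
  by (induction t arbitrary: h) auto

lemma finite_paths: "finite (paths t)"
  by (induction t) auto

lemma paths_bounded: "h \<in> paths t \<Longrightarrow> set h \<subseteq> {- int t..int t}"
proof (induction t arbitrary: h)
  case (Suc t)
  then obtain g where g: "g \<in> paths t" "h = (hd g + 1) # g \<or> h = (hd g - 1) # g" by auto
  then have "hd g \<in> set g" using paths_nonempty by auto
  then show ?case using Suc.IH[OF g(1)] g(2) by fastforce
qed auto

lemma paths_Suc_cases:
  assumes "h \<in> paths (Suc t)"
  obtains z g where "z # g \<in> paths t" "h = (z + 1) # z # g \<or> h = (z - 1) # z # g"
proof -
  from assms obtain g where "g \<in> paths t" "h = (hd g + 1) # g \<or> h = (hd g - 1) # g" by auto
  moreover from this have "g \<noteq> []" using paths_nonempty by blast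
  ultimately show ?thesis using that[of "hd g" "tl g"] by auto
qed

text \<open>A nearest-neighbour path crosses the edge between \<open>x\<close> and
  \<open>x + 1\<close> alternately in the two directions, so the difference depends only on the
  sides on which it starts and ends.\<close>

lemma up_minus_down:
  "h \<in> paths t \<Longrightarrow> int (up x h) - int (down (x + 1) h) =
     (if hd h \<ge> x + 1 then 1 else 0) - (if 0 \<ge> x + 1 then 1 else 0)"
proof (induction t arbitrary: h)
  case (Suc t)
  from Suc.prems obtain z g where "z # g \<in> paths t" "h = (z + 1) # z # g \<or> h = (z - 1) # z # g"
    by (rule paths_Suc_cases)
  with Suc.IH[of "z # g"] show ?case by (auto split: if_splits)
qed auto

text \<open>Every visit to \<open>x\<close>, except one at time 0, is an arrival from one of the two
  neighbours.\<close>

lemma count_list_eq_crossings: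
  "h \<in> paths t \<Longrightarrow> count_list h x = up (x - 1) h + down (x + 1) h + (if x = 0 then 1 else 0)"
proof (induction t arbitrary: h)
  case (Suc t)
  from Suc.prems obtain z g where "z # g \<in> paths t" "h = (z + 1) # z # g \<or> h = (z - 1) # z # g"
    by (rule paths_Suc_cases)
  with Suc.IH[of "z # g"] show ?case by (auto split: if_splits)
qed auto

lemma up_le_count_list: "h \<in> paths t \<Longrightarrow> up x h \<le> count_list h (x + 1)"
  using count_list_eq_crossings[of h t "x + 1"] by simp

lemma trunc_eq: "n \<notin> set h \<Longrightarrow> trunc n h = h"
  by (cases h) auto

text \<open>Stopping leaves a genuine, possibly shorter path, so bounds for \<open>paths\<close>
  apply to it; \<open>n\<close> can only be its newest entry.\<close>

lemma trunc_paths: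
  "h \<in> paths t \<Longrightarrow> \<exists>s\<le>t. trunc n h \<in> paths s \<and> n \<notin> set (tl (trunc n h))"
proof (induction t arbitrary: h)
  case (Suc t)
  from Suc.prems obtain z g where zg: "z # g \<in> paths t" "h = (z + 1) # z # g \<or> h = (z - 1) # z # g"
    by (rule paths_Suc_cases)
  show ?case
  proof (cases "n \<in> set (z # g)")
    case True
    then have "trunc n h = trunc n (z # g)" using zg(2) by auto
    then show ?thesis using Suc.IH[OF zg(1)] by (metis le_SucI)
  next
    case False
    then have "trunc n h = h" "n \<notin> set (tl h)" using zg(2) by auto
    then show ?thesis using Suc.prems by (metis le_refl)
  qed
qed auto

lemma count_list_one_if_notin_tl: "n \<notin> set (tl h) \<Longrightarrow> count_list h n \<le> 1"
  by (cases h) auto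

text \<open>This gives the recursion for the crossing moments finite support.\<close>

lemma up_eq_0: "h \<in> paths t \<Longrightarrow> x < - int t \<Longrightarrow> up x h = 0"
proof (induction t arbitrary: h)
  case (Suc t)
  from Suc.prems(1) obtain z g where zg: "z # g \<in> paths t" "h = (z + 1) # z # g \<or> h = (z - 1) # z # g"
    by (rule paths_Suc_cases)
  have "z \<noteq> x" using paths_bounded[OF zg(1)] Suc.prems(2) by auto
  then show ?case using Suc.IH[OF zg(1)] zg(2) Suc.prems(2) by auto
qed auto

section \<open>Expectations over paths of a fixed length\<close>

definition path_exp :: "(nat \<Rightarrow> real) \<Rightarrow> nat \<Rightarrow> (int list \<Rightarrow> real) \<Rightarrow> real" where
  "path_exp w t F = (\<Sum>h\<in>paths t. path_wt w h * F h)"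

lemma path_exp_add: "path_exp w t (\<lambda>h. F h + G h) = path_exp w t F + path_exp w t G"
  and path_exp_diff: "path_exp w t (\<lambda>h. F h - G h) = path_exp w t F - path_exp w t G"
  and path_exp_cmult: "path_exp w t (\<lambda>h. a * F h) = a * path_exp w t F"
  unfolding path_exp_def
  by (simp_all add: algebra_simps sum.distrib sum_subtractf sum_distrib_left)

lemma path_exp_0: "path_exp w 0 F = F [0]"
  by (simp add: path_exp_def)

locale vrrw_weight =
  fixes w :: "nat \<Rightarrow> real"
  assumes w_pos: "w k > 0"
begin

lemma step_prob_nonneg: "step_prob w h y \<ge> 0"
  unfolding step_prob_def Let_def
  using w_pos[of "count_list h (hd h - 1)"] w_pos[of "count_list h (hd h + 1)"] by auto

lemma step_prob_le_1: "step_prob w h y \<le> 1"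
  unfolding step_prob_def Let_def
  using w_pos[of "count_list h (hd h - 1)"] w_pos[of "count_list h (hd h + 1)"]
  by (auto simp: divide_simps)

lemma path_wt_nonneg: "path_wt w h \<ge> 0"
  by (induction h rule: induct_list012) (auto simp: step_prob_nonneg)

lemma step_prob_sum: "step_prob w h (hd h + 1) + step_prob w h (hd h - 1) = 1"
  unfolding step_prob_def Let_def
  using w_pos[of "count_list h (hd h - 1)"] w_pos[of "count_list h (hd h + 1)"]
  by (simp flip: add_divide_distrib)

lemma path_exp_Suc:
  "path_exp w (Suc t) F = path_exp w t (\<lambda>h. step_prob w h (hd h + 1) * F ((hd h + 1) # h)
      + step_prob w h (hd h - 1) * F ((hd h - 1) # h))"
proof -
  have wt: "path_wt w (y # h) = step_prob w h y * path_wt w h" if "h \<in> paths t" for h y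
    using paths_nonempty[OF that] by (cases h) auto
  have "path_exp w (Suc t) F = (\<Sum>h\<in>(\<lambda>h. (hd h + 1) # h) ` paths t. path_wt w h * F h)
      + (\<Sum>h\<in>(\<lambda>h. (hd h - 1) # h) ` paths t. path_wt w h * F h)"
    unfolding path_exp_def paths.simps by (intro sum.union_disjoint) (auto simp: finite_paths)
  also have "\<dots> = (\<Sum>h\<in>paths t. path_wt w ((hd h + 1) # h) * F ((hd h + 1) # h))
      + (\<Sum>h\<in>paths t. path_wt w ((hd h - 1) # h) * F ((hd h - 1) # h))"
    by (subst (1 2) sum.reindex) (auto simp: inj_on_def)
  also have "\<dots> = (\<Sum>h\<in>paths t. path_wt w h * (step_prob w h (hd h + 1) * F ((hd h + 1) # h)
      + step_prob w h (hd h - 1) * F ((hd h - 1) # h)))"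
    unfolding sum.distrib[symmetric] by (intro sum.cong) (auto simp: wt algebra_simps)
  finally show ?thesis unfolding path_exp_def .
qed

lemma path_exp_mono: "(\<And>h. h \<in> paths t \<Longrightarrow> F h \<le> G h) \<Longrightarrow> path_exp w t F \<le> path_exp w t G"
  unfolding path_exp_def by (intro sum_mono mult_left_mono path_wt_nonneg)

lemma path_exp_const: "path_exp w t (\<lambda>_. a) = a"
proof (induction t)
  case (Suc t)
  have "path_exp w (Suc t) (\<lambda>_. a) = path_exp w t (\<lambda>h. (step_prob w h (hd h + 1) + step_prob w h (hd h - 1)) * a)"
    unfolding path_exp_Suc by (simp add: algebra_simps)
  then show ?case using Suc step_prob_sum by simp
qed (simp add: path_exp_0)

text \<open>Optional stopping, by induction on \<open>t\<close>: once \<open>n\<close> is hit the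
  truncated path is frozen, and before that one more step preserves the mean of
  \<open>G\<close>.\<close>

lemma path_exp_trunc_martingale:
  assumes mart: "\<And>h. h \<noteq> [] \<Longrightarrow> step_prob w h (hd h + 1) * G ((hd h + 1) # h)
      + step_prob w h (hd h - 1) * G ((hd h - 1) # h) = G h"
  shows "path_exp w t (\<lambda>h. G (trunc n h)) = G [0]"
proof (induction t)
  case (Suc t)
  have "path_exp w (Suc t) (\<lambda>h. G (trunc n h)) = path_exp w t (\<lambda>h. G (trunc n h))"
    unfolding path_exp_Suc unfolding path_exp_def
  proof (intro sum.cong refl arg_cong2[where f = "(*)"])
    fix h assume h: "h \<in> paths t"
    show "step_prob w h (hd h + 1) * G (trunc n ((hd h + 1) # h))
        + step_prob w h (hd h - 1) * G (trunc n ((hd h - 1) # h)) = G (trunc n h)"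
    proof (cases "n \<in> set h")
      case True
      then show ?thesis using step_prob_sum[of h] by (simp flip: distrib_right)
    next
      case False
      then have "trunc n h = h" by (rule trunc_eq)
      then show ?thesis using False mart[of h] paths_nonempty[OF h] by simp
    qed
  qed
  then show ?case using Suc by simp
qed (simp add: path_exp_0)

text \<open>A jump from \<open>x\<close> to a neighbour with local time \<open>k\<close> has probability proportional to \<open>w k\<close>;
  weighting it by \<open>1 / w k\<close> makes the two directions balance.\<close>
lemma path_exp_Yup_eq_Ydown:
  "path_exp w t (\<lambda>h. Yup w x (trunc n h)) = path_exp w t (\<lambda>h. Ydown w x (trunc n h))"
proof -
  define G where "G h = Yup w x h - Ydown w x h" for h
  have "path_exp w t (\<lambda>h. G (trunc n h)) = G [0]"
  proof (rule path_exp_trunc_martingale)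
    fix h :: "int list" assume "h \<noteq> []"
    then obtain z g where h: "h = z # g" by (cases h) auto
    let ?p = "step_prob w h (z + 1)" and ?q = "step_prob w h (z - 1)"
    let ?a = "w (count_list h (z + 1))" and ?b = "w (count_list h (z - 1))"
    have pos: "?a > 0" "?b > 0" using w_pos by auto
    \<comment> \<open>Both products are the reciprocal of the normalising sum
      \<open>?a + ?b\<close>.\<close>
    have eq: "?p * (1 / ?a) = ?q * (1 / ?b)"
      using pos by (simp add: step_prob_def Let_def h)
    have "?p * G ((z + 1) # h) + ?q * G ((z - 1) # h) = (?p + ?q) * G h
       + (if z = x then ?p * (1 / ?a) - ?q * (1 / ?b) else 0)"
      unfolding G_def h by (auto simp: algebra_simps)
    also have "\<dots> = (?p + ?q) * G h" unfolding eq by simp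
    also have "\<dots> = G h" using step_prob_sum[of h] by (simp add: h)
    finally show "step_prob w h (hd h + 1) * G ((hd h + 1) # h)
      + step_prob w h (hd h - 1) * G ((hd h - 1) # h) = G h"
      by (simp add: h)
  qed
  then show ?thesis by (simp add: G_def path_exp_diff)
qed

end

section \<open>Moments of the crossing numbers before a hitting time\<close>

text \<open>A discrete comparison with an integral: Young's inequality with weights
  \<open>1 - \<alpha>\<close> and \<open>\<alpha>\<close> bounds the increment of
  \<open>N powr (1 - \<alpha>)\<close> from below.\<close>

lemma sum_powr_le:
  fixes \<alpha> :: real
  assumes "0 \<le> \<alpha>" "\<alpha> < 1"
  shows "(\<Sum>j<N. (real j + 1) powr (-\<alpha>)) \<le> real N powr (1 - \<alpha>) / (1 - \<alpha>)"
proof (induction N)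
  case (Suc N)
  let ?N = "real N"
  have "?N powr (1 - \<alpha>) * (?N + 1) powr \<alpha> \<le> (1 - \<alpha>) * ?N + \<alpha> * (?N + 1)"
  proof (cases "N = 0")
    case False
    then show ?thesis using Youngs_inequality_0[of "1 - \<alpha>" \<alpha> ?N "?N + 1"] assms by simp
  qed (use assms in auto)
  then have "(1 - \<alpha>) \<le> (?N + 1) - ?N powr (1 - \<alpha>) * (?N + 1) powr \<alpha>"
    by (simp add: algebra_simps)
  then have "(1 - \<alpha>) * (?N + 1) powr (-\<alpha>) \<le>
      ((?N + 1) - ?N powr (1 - \<alpha>) * (?N + 1) powr \<alpha>) * (?N + 1) powr (-\<alpha>)"
    by (intro mult_right_mono) auto
  also have "\<dots> = (?N + 1) powr (1 - \<alpha>) - ?N powr (1 - \<alpha>)"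
    using powr_mult_base[of "?N + 1" "-\<alpha>"] by (simp add: left_diff_distrib flip: powr_add)
  finally have "(?N + 1) powr (-\<alpha>) \<le> ((?N + 1) powr (1 - \<alpha>) - ?N powr (1 - \<alpha>)) / (1 - \<alpha>)"
    using assms by (simp add: field_simps)
  with Suc show ?case by (simp add: diff_divide_distrib add_ac)
qed auto

text \<open>The supremum \<open>m\<close> of \<open>e i / (2 \<Lambda>)^i\<close> satisfies \<open>m \<le> 3/4 m + 2\<close>; it is finite
  because \<open>e\<close> has finite support.\<close>
lemma geometric_bound_of_three_term_recursion:
  fixes e :: "nat \<Rightarrow> real"
  assumes e0: "e 0 \<le> 1" and nonneg: "\<And>i. 0 \<le> e i"
    and rec: "\<And>i. e (Suc i) \<le> \<Lambda> * e i + \<delta> * e (Suc (Suc i)) + 2"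
    and fin: "\<And>i. i \<ge> I \<Longrightarrow> e i = 0"
    and \<Lambda>: "1 \<le> \<Lambda>" and \<delta>: "0 \<le> \<delta>" "\<delta> * \<Lambda> \<le> 1/8"
  shows "e i \<le> 8 * (2 * \<Lambda>) ^ i"
proof -
  define f where "f i = e i / (2 * \<Lambda>) ^ i" for i
  define m where "m = Max (f ` {..I})"
  have ef: "e i = f i * (2 * \<Lambda>) ^ i" for i using \<Lambda> by (simp add: f_def)
  have f_nonneg: "0 \<le> f i" for i using nonneg \<Lambda> by (simp add: f_def)
  have fm: "f i \<le> m" for i
  proof (cases "i \<le> I")
    case False
    then have "f i = 0" using fin[of i] by (simp add: f_def)
    also have "0 \<le> f 0" by (rule f_nonneg)
    also have "\<dots> \<le> m" unfolding m_def by (intro Max_ge) auto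
    finally show ?thesis .
  qed (auto simp: m_def)
  have m0: "0 \<le> m" using f_nonneg[of 0] fm[of 0] by linarith
  have "m \<in> f ` {..I}" unfolding m_def by (intro Max_in) auto
  then obtain j where j: "m = f j" by auto
  have "f j \<le> 3/4 * m + 2"
  proof (cases j)
    case 0
    then show ?thesis using e0 m0 by (simp add: f_def)
  next
    case (Suc k)
    define p where "p = (2 * \<Lambda>) ^ Suc k"
    have p1: "1 \<le> p" unfolding p_def using \<Lambda> by (intro one_le_power) auto
    \<comment> \<open>In units of \<open>p\<close> the neighbouring terms get the factors 1/2 and
      \<open>2 * (\<delta> * \<Lambda>)\<close>, the latter at most 1/4, and the constant 2 is at
      most \<open>2 * p\<close>.\<close>
    have "f j * p \<le> \<Lambda> * (f k * (2 * \<Lambda>) ^ k) + \<delta> * (f (Suc (Suc k)) * (2 * \<Lambda>) ^ Suc (Suc k)) + 2"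
      using rec[of k] unfolding Suc p_def by (simp only: ef)
    also have "\<dots> = (f k / 2 + 2 * (\<delta> * \<Lambda>) * f (Suc (Suc k))) * p + 2"
      unfolding p_def by (simp add: algebra_simps)
    also have "\<dots> \<le> (m / 2 + 2 * (1/8) * m) * p + 2 * p"
    proof (intro add_mono mult_right_mono)
      show "2 * (\<delta> * \<Lambda>) * f (Suc (Suc k)) \<le> 2 * (1/8) * m"
        using fm \<delta> \<Lambda> f_nonneg m0 by (intro mult_mono) auto
    qed (use p1 fm[of k] in auto)
    also have "\<dots> = (3/4 * m + 2) * p" by (simp add: algebra_simps)
    finally show ?thesis using p1 by (simp add: mult_le_cancel_right)
  qed
  then have "m \<le> 8" using j by simp
  then have "f i \<le> 8" using fm[of i] by linarith
  then show ?thesis unfolding ef using \<Lambda> by (intro mult_right_mono) auto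
qed

section \<open>Crossing moments under polynomial bounds on the weight\<close>

locale vrrw_weak = vrrw_weight +
  fixes \<alpha> c C :: real
  assumes \<alpha>: "0 \<le> \<alpha>" "\<alpha> < 1/2" and cC: "0 < c" "0 < C"
    and w_ge: "c * (real k + 1) powr \<alpha> \<le> w k"
    and w_le: "w k \<le> C * (real k + 1) powr \<alpha>"
begin

text \<open>When j jumps from \<open>x\<close> to \<open>x + 1\<close> have been made, the local
  time at \<open>x + 1\<close> is at least j, so the next such jump meets a weight of at least
  \<open>c * (j + 1) powr \<alpha>\<close>; then \<open>sum_powr_le\<close> applies.\<close>

lemma Yup_le:
  assumes "h \<in> paths t"
  shows "Yup w x h \<le> real (up x h) powr (1 - \<alpha>) / (c * (1 - \<alpha>))"
proof -
  have "Yup w x h \<le> (1 / c) * (\<Sum>j<up x h. (real j + 1) powr (-\<alpha>))"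
    using assms
  proof (induction t arbitrary: h)
    case (Suc t)
    from Suc.prems obtain z g where zg: "z # g \<in> paths t" "h = (z + 1) # z # g \<or> h = (z - 1) # z # g"
      by (rule paths_Suc_cases)
    let ?u = "up x (z # g)" and ?k = "count_list (z # g) (x + 1)"
    have "c * (real ?u + 1) powr \<alpha> \<le> c * (real ?k + 1) powr \<alpha>"
      using up_le_count_list[OF zg(1), of x] \<alpha> cC by (intro mult_left_mono powr_mono2) auto
    also have "\<dots> \<le> w ?k" by (rule w_ge)
    finally have "1 / w ?k \<le> 1 / (c * (real ?u + 1) powr \<alpha>)"
      using cC w_pos by (intro divide_left_mono) auto
    also have "\<dots> = (1 / c) * (real ?u + 1) powr (-\<alpha>)"
      by (simp add: powr_minus divide_simps)
    finally have "1 / w ?k \<le> (1 / c) * (real ?u + 1) powr (-\<alpha>)" .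
    moreover have "Yup w x h = Yup w x (z # g) \<and> up x h = ?u \<or>
        Yup w x h = Yup w x (z # g) + 1 / w ?k \<and> up x h = Suc ?u"
      using zg(2) by auto
    ultimately show ?case using Suc.IH[OF zg(1)] by (auto simp: distrib_left add_divide_distrib add_mono)
  qed auto
  also have "\<dots> \<le> (1 / c) * (real (up x h) powr (1 - \<alpha>) / (1 - \<alpha>))"
    using cC \<alpha> by (intro mult_left_mono sum_powr_le) auto
  finally show ?thesis by simp
qed

text \<open>Local times are bounded above by their final value, so all jumps share one lower bound
  for their contribution.\<close>

lemma Ydown_ge:
  assumes "h \<in> paths t"
  shows "real (down x h) * (real (count_list h (x - 1)) + 1) powr (-\<alpha>) \<le> C * Ydown w x h"
  using assms
proof (induction t arbitrary: h)
  case (Suc t)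
  from Suc.prems obtain z g where zg: "z # g \<in> paths t" "h = (z + 1) # z # g \<or> h = (z - 1) # z # g"
    by (rule paths_Suc_cases)
  let ?d = "down x (z # g)" and ?k = "count_list (z # g) (x - 1)" and ?k' = "count_list h (x - 1)"
  have kk: "(real ?k' + 1) powr (-\<alpha>) \<le> (real ?k + 1) powr (-\<alpha>)"
    using zg(2) \<alpha> by (intro powr_mono2') auto
  have "(real ?k + 1) powr (-\<alpha>) \<le> C * (1 / w ?k)"
    using w_le[of ?k] w_pos[of ?k] cC by (simp add: powr_minus divide_simps)
  then have 1: "(real ?k' + 1) powr (-\<alpha>) \<le> C * (1 / w ?k)" using kk by linarith
  have "real ?d * (real ?k' + 1) powr (-\<alpha>) \<le> real ?d * (real ?k + 1) powr (-\<alpha>)"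
    using kk by (intro mult_left_mono) auto
  also have "\<dots> \<le> C * Ydown w x (z # g)" by (rule Suc.IH[OF zg(1)])
  finally have 2: "real ?d * (real ?k' + 1) powr (-\<alpha>) \<le> C * Ydown w x (z # g)" .
  have "down x h = ?d \<and> Ydown w x h = Ydown w x (z # g) \<or>
      down x h = ?d + 1 \<and> Ydown w x h = Ydown w x (z # g) + 1 / w ?k"
    using zg(2) by auto
  then show ?case using 1 2 by (auto simp: distrib_left distrib_right)
qed auto

text \<open>If the jumps into \<open>x\<close> from the left are at most \<open>B\<close> times the
  jumps out to the right, the local time at \<open>x\<close> is of order \<open>up x h\<close>, and
  \<open>Ydown_ge\<close> turns crossings into weighted ones. Otherwise \<open>up x h\<close> is
  smaller than \<open>up (x - 1) h\<close> by the factor \<open>B\<close>. The constant 2 absorbs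
  the case of few crossings.\<close>

lemma up_powr_le:
  assumes h: "h \<in> paths t" and B: "1 \<le> B"
  shows "real (up x h) powr (1 - \<alpha>) \<le> 2 * (B + 3) powr \<alpha> * C * Ydown w (x + 1) h
      + B powr (\<alpha> - 1) * real (up (x - 1) h) powr (1 - \<alpha>) + 2"
proof -
  let ?U = "real (up x h)" and ?V = "real (up (x - 1) h)" and ?D = "real (down (x + 1) h)"
  let ?k = "real (count_list h x)"
  have DU: "?U - 1 \<le> ?D" and UD: "?D \<le> ?U + 1"
    using up_minus_down[OF h, of x] by (auto split: if_splits)
  have k: "?k + 1 \<le> ?V + ?U + 3"
    using count_list_eq_crossings[OF h, of x] UD by (auto split: if_splits)
  have Y: "?D * (?k + 1) powr (-\<alpha>) \<le> C * Ydown w (x + 1) h"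
    using Ydown_ge[OF h, of "x + 1"] by simp
  have Y0: "0 \<le> C * Ydown w (x + 1) h"
    by (rule order_trans[OF _ Y]) auto
  consider "?U \<le> 2" | "?U > 2" "?V \<le> B * ?U" | "?U > 2" "?V > B * ?U" by linarith
  then show ?thesis
  proof cases
    case 1
    have "?U powr (1 - \<alpha>) \<le> 2 powr (1 - \<alpha>)" using 1 \<alpha> by (intro powr_mono2) auto
    also have "\<dots> \<le> 2 powr 1" using \<alpha> by (intro powr_mono) auto
    finally have "?U powr (1 - \<alpha>) \<le> 2" by simp
    moreover have "0 \<le> 2 * (B + 3) powr \<alpha> * (C * Ydown w (x + 1) h)"
      by (intro mult_nonneg_nonneg[OF _ Y0]) auto
    moreover have "0 \<le> B powr (\<alpha> - 1) * ?V powr (1 - \<alpha>)" by auto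
    ultimately show ?thesis unfolding mult.assoc by linarith
  next
    case 2
    \<comment> \<open>The bound \<open>?U > 2\<close> gives \<open>3 \<le> 2 * ?U\<close> here and
      \<open>?U / 2 \<le> ?D\<close> below.\<close>
    have "?k + 1 \<le> (B + 3) * ?U" using k 2 by (simp add: algebra_simps)
    then have "((B + 3) * ?U) powr (-\<alpha>) \<le> (?k + 1) powr (-\<alpha>)"
      using \<alpha> by (intro powr_mono2') auto
    then have "?U / 2 * ((B + 3) * ?U) powr (-\<alpha>) \<le> ?D * (?k + 1) powr (-\<alpha>)"
      using DU 2 by (intro mult_mono) auto
    also note Y
    finally have Z: "?U / 2 * ((B + 3) * ?U) powr (-\<alpha>) \<le> C * Ydown w (x + 1) h" .
    have "?U powr (1 - \<alpha>) = 2 * (B + 3) powr \<alpha> * (?U / 2 * ((B + 3) * ?U) powr (-\<alpha>))"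
      using B 2 powr_mult_base[of ?U "-\<alpha>"] by (simp add: powr_mult powr_minus mult.left_commute)
    also have "\<dots> \<le> 2 * (B + 3) powr \<alpha> * (C * Ydown w (x + 1) h)"
      using Z by (intro mult_left_mono) auto
    moreover have "0 \<le> B powr (\<alpha> - 1) * ?V powr (1 - \<alpha>)" by auto
    ultimately show ?thesis unfolding mult.assoc by linarith
  next
    case 3
    have "B powr (1 - \<alpha>) * ?U powr (1 - \<alpha>) = (B * ?U) powr (1 - \<alpha>)"
      using B by (simp add: powr_mult)
    also have "\<dots> \<le> ?V powr (1 - \<alpha>)" using 3 B \<alpha> by (intro powr_mono2) auto
    finally have "B powr (\<alpha> - 1) * (B powr (1 - \<alpha>) * ?U powr (1 - \<alpha>)) \<le> B powr (\<alpha> - 1) * ?V powr (1 - \<alpha>)"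
      by (intro mult_left_mono) auto
    moreover have "B powr (\<alpha> - 1) * (B powr (1 - \<alpha>) * ?U powr (1 - \<alpha>)) = ?U powr (1 - \<alpha>)"
      using B by (simp flip: powr_add mult.assoc)
    moreover have "0 \<le> 2 * (B + 3) powr \<alpha> * (C * Ydown w (x + 1) h)"
      by (intro mult_nonneg_nonneg[OF _ Y0]) auto
    ultimately show ?thesis unfolding mult.assoc by linarith
  qed
qed

text \<open>In expectation \<open>Ydown\<close> at \<open>x + 1\<close> may be replaced by
  \<open>Yup\<close> at \<open>x + 1\<close>, which \<open>Yup_le\<close> controls by the crossing
  moment there. Counting sites leftwards from \<open>n\<close>, this is the three-term
  recursion.\<close>

lemma path_exp_up_recursion:
  assumes B: "1 \<le> B"
  shows "path_exp w t (\<lambda>h. real (up x (trunc n h)) powr (1 - \<alpha>)) \<le>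
    2 * (B + 3) powr \<alpha> * C / (c * (1 - \<alpha>)) * path_exp w t (\<lambda>h. real (up (x + 1) (trunc n h)) powr (1 - \<alpha>))
    + B powr (\<alpha> - 1) * path_exp w t (\<lambda>h. real (up (x - 1) (trunc n h)) powr (1 - \<alpha>)) + 2"
    (is "?e x \<le> ?L * _ + ?d * _ + 2")
proof -
  let ?K = "2 * (B + 3) powr \<alpha> * C"
  have "?e x \<le> path_exp w t (\<lambda>h. ?K * Ydown w (x + 1) (trunc n h)
      + ?d * real (up (x - 1) (trunc n h)) powr (1 - \<alpha>) + 2)"
    by (intro path_exp_mono) (use trunc_paths up_powr_le[OF _ B] in blast)
  also have "\<dots> = ?K * path_exp w t (\<lambda>h. Yup w (x + 1) (trunc n h)) + ?d * ?e (x - 1) + 2"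
    by (simp only: path_exp_add path_exp_cmult path_exp_const path_exp_Yup_eq_Ydown)
  also have "path_exp w t (\<lambda>h. Yup w (x + 1) (trunc n h)) \<le>
      path_exp w t (\<lambda>h. 1 / (c * (1 - \<alpha>)) * real (up (x + 1) (trunc n h)) powr (1 - \<alpha>))"
  proof (intro path_exp_mono)
    fix h assume "h \<in> paths t"
    then obtain s where "trunc n h \<in> paths s" using trunc_paths by blast
    from Yup_le[OF this, of "x + 1"]
    show "Yup w (x + 1) (trunc n h) \<le> 1 / (c * (1 - \<alpha>)) * real (up (x + 1) (trunc n h)) powr (1 - \<alpha>)"
      by simp
  qed
  finally show ?thesis using cC by (simp only: path_exp_cmult) (simp add: mult_left_mono)
qed

text \<open>Here \<open>\<alpha> < 1/2\<close> is used: the product of the two coefficients of the recursion is of order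
  \<open>B powr (2 * \<alpha> - 1)\<close>.\<close>
lemma path_exp_up_bounded:
  obtains \<Lambda> where "1 \<le> \<Lambda>"
    "\<And>n t i. path_exp w t (\<lambda>h. real (up (n - 1 - int i) (trunc n h)) powr (1 - \<alpha>)) \<le> 8 * (2 * \<Lambda>) ^ i"
proof -
  define A where "A = C / (c * (1 - \<alpha>))"
  have "c \<le> C" using w_ge[of 0] w_le[of 0] by simp
  then have A1: "1 \<le> A" 
  proof -
    have "c * (1 - \<alpha>) \<le> c * 1" using cC \<alpha> by (intro mult_left_mono) auto
    then have "c * (1 - \<alpha>) \<le> C" using \<open>c \<le> C\<close> by linarith
    then show ?thesis unfolding A_def using cC \<alpha> by (simp add: pos_le_divide_eq)
  qed
  have "((\<lambda>B. 4 * A * B powr (2 * \<alpha> - 1)) \<longlongrightarrow> 4 * A * 0) at_top"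
    using \<alpha> by (intro tendsto_mult tendsto_const tendsto_neg_powr filterlim_ident) auto
  then have "eventually (\<lambda>B. 4 * A * B powr (2 * \<alpha> - 1) < 1/8) at_top"
    by (intro order_tendstoD) auto
  then have "eventually (\<lambda>B. 4 * A * B powr (2 * \<alpha> - 1) < 1/8 \<and> 3 \<le> B) at_top"
    using eventually_ge_at_top by (rule eventually_conj)
  \<comment> \<open>The first condition makes the product of the two coefficients small;
    \<open>3 \<le> B\<close> serves to bound \<open>B + 3\<close> by \<open>2 * B\<close>.\<close>
  then obtain B :: real where B: "4 * A * B powr (2 * \<alpha> - 1) < 1/8" "3 \<le> B"
    by (auto dest: eventually_happens)
  define \<Lambda> where "\<Lambda> = 2 * (B + 3) powr \<alpha> * A"
  define \<delta> where "\<delta> = B powr (\<alpha> - 1)"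
  have "1 powr \<alpha> \<le> (B + 3) powr \<alpha>" using B \<alpha> by (intro powr_mono2) auto
  then have "1 * 1 \<le> (B + 3) powr \<alpha> * A" using A1 by (intro mult_mono) auto
  then have \<Lambda>: "1 \<le> \<Lambda>" unfolding \<Lambda>_def by simp
  have "(B + 3) powr \<alpha> \<le> (2 * B) powr \<alpha>" using B \<alpha> by (intro powr_mono2) auto
  also have "\<dots> = 2 powr \<alpha> * B powr \<alpha>" using B by (simp add: powr_mult)
  also have "\<dots> \<le> 2 * B powr \<alpha>"
    using powr_mono[of \<alpha> 1 2] \<alpha> by (intro mult_right_mono) auto
  finally have "\<delta> * \<Lambda> \<le> \<delta> * (2 * (2 * B powr \<alpha>) * A)"
    unfolding \<Lambda>_def \<delta>_def using A1 by (intro mult_left_mono mult_right_mono) auto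
  also have "\<dots> = 4 * A * (B powr (\<alpha> - 1) * B powr \<alpha>)" by (simp add: \<delta>_def)
  also have "B powr (\<alpha> - 1) * B powr \<alpha> = B powr (2 * \<alpha> - 1)" by (simp flip: powr_add)
  finally have \<delta>\<Lambda>: "\<delta> * \<Lambda> \<le> 1/8" using B by linarith
  have "path_exp w t (\<lambda>h. real (up (n - 1 - int i) (trunc n h)) powr (1 - \<alpha>)) \<le> 8 * (2 * \<Lambda>) ^ i" for n t i
  proof -
    define e where "e i = path_exp w t (\<lambda>h. real (up (n - 1 - int i) (trunc n h)) powr (1 - \<alpha>))" for i :: nat
    \<comment> \<open>The stopped path visits \<open>n\<close> at most once, so it jumps from
      \<open>n - 1\<close> to \<open>n\<close> at most once.\<close>
    have e_le_1: "e 0 \<le> path_exp w t (\<lambda>_. 1)" unfolding e_def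
    proof (intro path_exp_mono)
      fix h assume "h \<in> paths t"
      then obtain s where s: "trunc n h \<in> paths s" "n \<notin> set (tl (trunc n h))"
        using trunc_paths by blast
      have "up (n - 1) (trunc n h) \<le> 1"
        using up_le_count_list[OF s(1), of "n - 1"] count_list_one_if_notin_tl[OF s(2)] by simp
      then have "real (up (n - 1) (trunc n h)) powr (1 - \<alpha>) \<le> 1 powr (1 - \<alpha>)"
        using \<alpha> by (intro powr_mono2) auto
      then show "real (up (n - 1 - int 0) (trunc n h)) powr (1 - \<alpha>) \<le> 1" by simp
    qed
    have e_nonneg: "0 \<le> e j" for j
      unfolding e_def using path_exp_mono[of t "\<lambda>_. 0"] by (simp add: path_exp_const)
    have e_rec: "e (Suc j) \<le> \<Lambda> * e j + \<delta> * e (Suc (Suc j)) + 2" for j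
    proof -
      have "n - 1 - int (Suc j) + 1 = n - 1 - int j" "n - 1 - int (Suc j) - 1 = n - 1 - int (Suc (Suc j))"
        by auto
      then show ?thesis
        using path_exp_up_recursion[of B t "n - 1 - int (Suc j)" n] B
        unfolding e_def \<Lambda>_def \<delta>_def A_def by (simp only: times_divide_eq_right)
    qed
    \<comment> \<open>From this index on the site lies to the left of
      \<open>- int t\<close>.\<close>
    have e_fin: "e j = 0" if "j \<ge> nat (n + int t)" for j
    proof -
      have "up (n - 1 - int j) (trunc n h) = 0" if "h \<in> paths t" for h
      proof -
        obtain s where "s \<le> t" "trunc n h \<in> paths s" using trunc_paths \<open>h \<in> paths t\<close> by blast
        then show ?thesis using up_eq_0[of "trunc n h" s] \<open>j \<ge> nat (n + int t)\<close> by auto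
      qed
      then show ?thesis unfolding e_def path_exp_def by simp
    qed
    show ?thesis
      using geometric_bound_of_three_term_recursion[where e = e and I = "nat (n + int t)", of \<Lambda> \<delta> i]
        e_le_1 e_nonneg e_rec e_fin \<Lambda> \<delta>\<Lambda>
      by (simp add: path_exp_const e_def \<delta>_def)
  qed
  with \<Lambda> that show ?thesis by blast
qed

end

section \<open>The walk and its histories\<close>

lemma loc_time_uminus: "loc_time (\<lambda>i. - f i) n y = loc_time f n (- y)"
  unfolding loc_time_def by (rule arg_cong[where f = card]) auto

text \<open>Reflection exchanges the two neighbours together with their local times; results about
  the right side thereby carry over to the left.\<close>

lemma is_vrrw_uminus:
  assumes "is_vrrw M X w"
  shows "is_vrrw M (\<lambda>n \<omega>. - X n \<omega>) w"
proof -
  have step: "vrrw_step w (\<lambda>i. - f i) k = vrrw_step w f k" for f k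
  proof -
    have "- (- f k - 1) = f k + 1" "- (- f k + 1) = f k - 1" by auto
    moreover have "- f (Suc k) = - f k + 1 \<longleftrightarrow> f (Suc k) = f k - 1"
      "- f (Suc k) = - f k - 1 \<longleftrightarrow> f (Suc k) = f k + 1" by auto
    ultimately show ?thesis by (simp add: vrrw_step_def Let_def loc_time_uminus add.commute)
  qed
  have path: "vrrw_path_prob w (\<lambda>i. - f i) n = vrrw_path_prob w f n" for f n
    by (simp add: vrrw_path_prob_def step)
  have "{\<omega> \<in> space M. \<forall>i\<le>n. - X i \<omega> = f i} = {\<omega> \<in> space M. \<forall>i\<le>n. X i \<omega> = - f i}" for f n
    by (auto simp: minus_equation_iff)
  then show ?thesis using assms path unfolding is_vrrw_def
    by (auto intro: measurable_compose[where g = uminus])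
qed

section \<open>Histories of the walk as lists\<close>

primrec hist :: "(nat \<Rightarrow> 'a \<Rightarrow> int) \<Rightarrow> nat \<Rightarrow> 'a \<Rightarrow> int list" where
  "hist X 0 \<omega> = [X 0 \<omega>]"
| "hist X (Suc t) \<omega> = X (Suc t) \<omega> # hist X t \<omega>"

lemma length_hist [simp]: "length (hist X t \<omega>) = Suc t"
  by (induction t) auto

lemma hist_nonempty [simp]: "hist X t \<omega> \<noteq> []"
  by (cases t) auto

lemma hd_hist [simp]: "hd (hist X t \<omega>) = X t \<omega>"
  by (cases t) auto

lemma set_hist: "set (hist X t \<omega>) = (\<lambda>i. X i \<omega>) ` {..t}"
  by (induction t) (auto simp: atMost_Suc)

lemma set_tl_hist: "set (tl (hist X t \<omega>)) = (\<lambda>i. X i \<omega>) ` {..<t}"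
  by (cases t) (auto simp: set_hist lessThan_Suc_atMost)

lemma hist_eq_iff:
  "length h = Suc t \<Longrightarrow> hist X t \<omega> = h \<longleftrightarrow> (\<forall>i\<le>t. X i \<omega> = rev h ! i)"
proof (induction t arbitrary: h)
  case 0
  then show ?case by (cases h) auto
next
  case (Suc t)
  then obtain y g where h: "h = y # g" "length g = Suc t" by (cases h) auto
  show ?case using Suc.IH[OF h(2)] h
    by (auto simp: nth_append le_Suc_eq)
qed

lemma drop_hist: "i \<le> t \<Longrightarrow> drop (t - i) (hist X t \<omega>) = hist X i \<omega>"
proof (induction t)
  case (Suc t)
  then show ?case by (cases "i = Suc t") (auto simp: Suc_diff_le)
qed auto

lemma hist_append: "\<exists>g. hist X (r + m) \<omega> = g @ hist X r \<omega> \<and> length g = m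
    \<and> set g = (\<lambda>i. X i \<omega>) ` {r<..r + m}"
proof (induction m)
  case (Suc m)
  then obtain g where "hist X (r + m) \<omega> = g @ hist X r \<omega>" "length g = m"
      "set g = (\<lambda>i. X i \<omega>) ` {r<..r + m}" by blast
  moreover have "{r<..r + Suc m} = insert (r + Suc m) {r<..r + m}" by auto
  ultimately show ?case by (intro exI[of _ "X (r + Suc m) \<omega> # g"]) auto
qed auto

lemma count_list_hist_mono: "i \<le> t \<Longrightarrow> count_list (hist X i \<omega>) x \<le> count_list (hist X t \<omega>) x"
  by (induction t) (auto simp: le_Suc_eq)

lemma count_list_hist_unbounded:
  assumes "\<exists>\<^sub>\<infinity>i. X i \<omega> = x"
  shows "\<exists>t. K \<le> count_list (hist X t \<omega>) x"
proof (induction K)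
  case (Suc K)
  then obtain t where t: "K \<le> count_list (hist X t \<omega>) x" by blast
  obtain n where n: "n > t" "X n \<omega> = x" using assms unfolding INFM_nat by blast
  then obtain k where k: "n = Suc k" "t \<le> k" by (cases n) auto
  have "count_list (hist X n \<omega>) x = Suc (count_list (hist X k \<omega>) x)"
    using n k by simp
  then show ?case using t count_list_hist_mono[OF k(2), of X \<omega> x] by (intro exI[of _ n]) linarith
qed auto

text \<open>After any time \<open>m\<close> the path reaches a level above \<open>y\<close> and
  above everything seen up to \<open>m\<close>; on its way back to \<open>x\<close> it must pass
  \<open>y\<close>.\<close>

lemma hits_io_if_unbounded_above:
  fixes f :: "nat \<Rightarrow> int"
  assumes step: "\<And>i. \<bar>f (Suc i) - f i\<bar> \<le> 1" and io: "\<exists>\<^sub>\<infinity>i. f i = x"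
    and hit: "\<And>n. n > x \<Longrightarrow> \<exists>i. f i = n" and "x \<le> y"
  shows "\<exists>\<^sub>\<infinity>i. f i = y"
  unfolding INFM_nat
proof
  fix m
  define n where "n = Max (insert y (f ` {..m})) + 1"
  have le: "v < n" if "v \<in> insert y (f ` {..m})" for v
    using Max_ge[OF _ that] unfolding n_def by simp
  have "y < n" by (rule le) simp
  then obtain i where i: "f i = n" using hit[of n] \<open>x \<le> y\<close> by auto
  then have "i > m" using le[of "f i"] by force
  obtain j where j: "j > i" "f j = x" using io unfolding INFM_nat by blast
  \<comment> \<open>The path descends here, hence the minus signs in the discrete intermediate value
    theorem.\<close>
  have "\<exists>k\<ge>i. k \<le> j \<and> - f k = - y"
    using j i \<open>y < n\<close> \<open>x \<le> y\<close> step by (intro nat_intermed_int_val) (auto simp: abs_minus_commute)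
  then show "\<exists>k>m. f k = y" using \<open>i > m\<close> by (metis less_le_trans neg_equal_iff_equal)
qed

lemma hits_io_if_unbounded:
  fixes f :: "nat \<Rightarrow> int"
  assumes step: "\<And>i. \<bar>f (Suc i) - f i\<bar> \<le> 1" and io: "\<exists>\<^sub>\<infinity>i. f i = x"
    and hit: "\<And>n. \<exists>i. f i = n"
  shows "\<exists>\<^sub>\<infinity>i. f i = y"
proof (cases "x \<le> y")
  case True
  then show ?thesis using hits_io_if_unbounded_above[OF step io] hit by blast
next
  case False
  have "\<exists>\<^sub>\<infinity>i. - f i = - y"
  proof (rule hits_io_if_unbounded_above[of _ "- x"])
    show "\<exists>i. - f i = n" for n using hit[of "- n"] by (metis minus_minus)
    show "\<bar>- f (Suc i) - - f i\<bar> \<le> 1" for i using step[of i] by linarith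
  qed (use False io in auto)
  then show ?thesis by simp
qed

section \<open>The law of the histories\<close>

locale vrrw = vrrw_weak +
  fixes M :: "'a measure" and X :: "nat \<Rightarrow> 'a \<Rightarrow> int"
  assumes vrrw: "is_vrrw M X w"

sublocale vrrw \<subseteq> prob_space M
  using vrrw by (simp add: is_vrrw_def)

context vrrw
begin

lemma vrrw_reflected: "vrrw w \<alpha> c C M (\<lambda>n \<omega>. - X n \<omega>)"
  by unfold_locales (rule is_vrrw_uminus[OF vrrw])

lemma measurable_X [measurable]: "X n \<in> measurable M (count_space UNIV)"
  using vrrw by (simp add: is_vrrw_def)

lemma measurable_hist [measurable]: "hist X t \<in> measurable M (count_space UNIV)"
proof (induction t)
  case 0
  show ?case by simp
next
  case (Suc t)
  note [measurable] = Suc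
  show ?case unfolding hist.simps
    by (rule measurable_compose_countable[where f = "\<lambda>h \<omega>. X (Suc t) \<omega> # h" and g = "hist X t"]) auto
qed

lemma sets_hist: "{\<omega> \<in> space M. P (hist X t \<omega>)} \<in> sets M"
proof -
  have "hist X t -` {h. P h} \<inter> space M \<in> sets M"
    by (rule measurable_sets[OF measurable_hist]) simp
  moreover have "hist X t -` {h. P h} \<inter> space M = {\<omega> \<in> space M. P (hist X t \<omega>)}" by auto
  ultimately show ?thesis by simp
qed

text \<open>Paths are indexed by time in \<open>is_vrrw\<close> and listed newest first in
  \<open>path_wt\<close>. The proof peels off the last step, whose local times are counts in the
  earlier history.\<close>

lemma path_wt_eq_vrrw_path_prob:
  assumes "length h = Suc t"
  shows "path_wt w h = vrrw_path_prob w (\<lambda>i. rev h ! i) t"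
  using assms
proof (induction t arbitrary: h)
  case 0
  then show ?case by (cases h) (auto simp: vrrw_path_prob_def)
next
  case (Suc t)
  then obtain y z g where h: "h = y # z # g" "length g = t"
    by (metis length_Suc_conv)
  let ?f = "\<lambda>i. rev h ! i" and ?f' = "\<lambda>i. rev (z # g) ! i"
  have f_eq: "?f i = ?f' i" if "i \<le> t" for i
    using that h by (simp add: nth_append)
  have lt: "loc_time ?f k x = loc_time ?f' k x" if "k \<le> t" for k x
    unfolding loc_time_def by (rule arg_cong[where f = card]) (use f_eq that in auto)
  have lt_count: "loc_time ?f t x = count_list (z # g) x" for x
  proof -
    have "{m. m \<le> t \<and> ?f' m = x} = {m. m < length (rev (z # g)) \<and> rev (z # g) ! m = x}"
      using h by auto
    then have "loc_time ?f' t x = length (filter (\<lambda>a. a = x) (rev (z # g)))"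
      unfolding loc_time_def length_filter_conv_card by simp
    also have "(\<lambda>a. a = x) = (=) x" by auto
    also have "length (filter ((=) x) (rev (z # g))) = count_list (rev (z # g)) x"
      by (simp only: count_list_eq_length_filter)
    finally show ?thesis using lt[of t x] by simp
  qed
  have step_eq: "vrrw_step w ?f k = vrrw_step w ?f' k" if "k < t" for k
    using that unfolding vrrw_step_def
    by (simp only: f_eq[of k] f_eq[of "Suc k"] lt[of k] less_imp_le Suc_leI)
  have last: "vrrw_step w ?f t = step_prob w (z # g) y"
    using h unfolding vrrw_step_def step_prob_def lt_count by (simp add: nth_append Let_def)
  have "path_wt w h = step_prob w (z # g) y * vrrw_path_prob w ?f' t"
    using Suc.IH[of "z # g"] h by simp
  also have "\<dots> = vrrw_path_prob w ?f (Suc t)"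
    unfolding vrrw_path_prob_def using f_eq[of 0] last step_eq by (simp add: algebra_simps)
  finally show ?case .
qed

lemma prob_hist:
  assumes "length h = Suc t"
  shows "prob {\<omega> \<in> space M. hist X t \<omega> = h} = path_wt w h"
proof -
  have "{\<omega> \<in> space M. hist X t \<omega> = h} = {\<omega> \<in> space M. \<forall>i\<le>t. X i \<omega> = rev h ! i}"
    by (simp only: hist_eq_iff[OF assms])
  then show ?thesis using vrrw path_wt_eq_vrrw_path_prob[OF assms] unfolding is_vrrw_def by simp
qed

lemma prob_hist_finite:
  assumes "finite A" "\<And>h. h \<in> A \<Longrightarrow> length h = Suc t"
  shows "prob {\<omega> \<in> space M. hist X t \<omega> \<in> A} = (\<Sum>h\<in>A. path_wt w h)"
proof -
  have "{\<omega> \<in> space M. hist X t \<omega> \<in> A} = (\<Union>h\<in>A. {\<omega> \<in> space M. hist X t \<omega> = h})" by auto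
  also have "prob \<dots> = (\<Sum>h\<in>A. prob {\<omega> \<in> space M. hist X t \<omega> = h})"
    using assms(1) by (intro finite_measure_finite_Union) (auto simp: disjoint_family_on_def sets_hist)
  finally show ?thesis using assms(2) by (simp add: prob_hist)
qed

text \<open>By \<open>path_exp_const\<close> the nearest-neighbour paths from 0 carry total mass
  one.\<close>

lemma AE_hist_paths: "AE \<omega> in M. \<forall>t. hist X t \<omega> \<in> paths t"
proof (subst AE_all_countable, intro allI)
  fix t
  have "prob {\<omega> \<in> space M. hist X t \<omega> \<in> paths t} = path_exp w t (\<lambda>_. 1)"
    unfolding path_exp_def by (subst prob_hist_finite) (auto simp: finite_paths paths_length)
  then show "AE \<omega> in M. hist X t \<omega> \<in> paths t"
    using AE_prob_1[of "{\<omega> \<in> space M. hist X t \<omega> \<in> paths t}"]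
    by (auto simp: path_exp_const elim: AE_mp)
qed

text \<open>A form of Markov's inequality that moves bounds on finite sums to the measure
  \<open>M\<close>.\<close>

lemma prob_hist_le_path_exp:
  assumes "\<And>h. h \<in> paths t \<Longrightarrow> P h \<Longrightarrow> 1 \<le> F h" "\<And>h. 0 \<le> F h"
  shows "prob {\<omega> \<in> space M. P (hist X t \<omega>)} \<le> path_exp w t F"
proof -
  have "prob {\<omega> \<in> space M. P (hist X t \<omega>)} = prob {\<omega> \<in> space M. hist X t \<omega> \<in> {h \<in> paths t. P h}}"
    by (intro prob_eq_AE) (use AE_hist_paths in \<open>auto simp: sets_hist\<close>)
  also have "\<dots> = (\<Sum>h\<in>{h \<in> paths t. P h}. path_wt w h * 1)"
    by (subst prob_hist_finite) (auto simp: finite_paths paths_length)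
  also have "\<dots> \<le> (\<Sum>h\<in>{h \<in> paths t. P h}. path_wt w h * F h)"
    using assms by (intro sum_mono mult_left_mono path_wt_nonneg) auto
  also have "\<dots> \<le> path_exp w t F"
    unfolding path_exp_def using assms path_wt_nonneg
    by (intro sum_mono2) (auto simp: finite_paths)
  finally show ?thesis .
qed

end

section \<open>Comparison of shifted paths\<close>

text \<open>After the last visit to 0 the sign of \<open>f\<close> is fixed, and a bounded interval,
  being a finite set of sites, is visited only finitely often.\<close>

lemma eventually_one_sided_if_no_site_io:
  fixes f :: "nat \<Rightarrow> int"
  assumes step: "\<And>i. \<bar>f (Suc i) - f i\<bar> \<le> 1" and fin: "\<And>x. finite {i. f i = x}"
  shows "(\<forall>k. \<exists>m. \<forall>i\<ge>m. f i > k) \<or> (\<forall>k. \<exists>m. \<forall>i\<ge>m. - f i > k)"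
proof -
  have main: "\<forall>k. \<exists>m. \<forall>i\<ge>m. g i > k"
    if g: "\<And>i. \<bar>g (Suc i) - g i\<bar> \<le> 1" "\<And>x. finite {i. g i = x}"
      "\<And>i. i \<ge> m0 \<Longrightarrow> g i \<noteq> 0" "g m0 > 0" for g :: "nat \<Rightarrow> int" and m0
  proof
    fix k :: int
    have pos: "g i > 0" if "i \<ge> m0" for i
    proof (rule ccontr)
      assume "\<not> g i > 0"
      then have "\<exists>l\<ge>m0. l \<le> i \<and> - g l = 0"
        using that g(1,4) by (intro nat_intermed_int_val) (auto simp: abs_minus_commute)
      then show False using g(3) by auto
    qed
    have "{i. g i \<in> {0..k}} = (\<Union>x\<in>{0..k}. {i. g i = x})" by auto
    then have "finite {i. g i \<in> {0..k}}" using g(2) by simp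
    then obtain m1 where m1: "\<And>i. i \<in> {i. g i \<in> {0..k}} \<Longrightarrow> i < m1"
      using finite_nat_set_iff_bounded[of "{i. g i \<in> {0..k}}"] by blast
    have "g i > k" if "i \<ge> max m0 m1" for i
      using pos[of i] m1[of i] that by force
    then show "\<exists>m. \<forall>i\<ge>m. g i > k" by blast
  qed
  obtain m0 where m0: "\<And>i. i \<in> {i. f i = 0} \<Longrightarrow> i < m0"
    using fin[of 0] finite_nat_set_iff_bounded[of "{i. f i = 0}"] by blast
  then have nz: "f i \<noteq> 0" if "i \<ge> m0" for i using that by force
  show ?thesis
  proof (cases "f m0 > 0")
    case True
    then show ?thesis using main[of f m0] step fin nz by blast
  next
    case False
    have "\<forall>k. \<exists>m. \<forall>i\<ge>m. (\<lambda>i. - f i) i > k"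
    proof (rule main[of _ m0])
      have "{i. - f i = x} = {i. f i = - x}" for x by auto
      then show "finite {i. - f i = x}" for x using fin by simp
      show "\<bar>- f (Suc i) - - f i\<bar> \<le> 1" for i using step[of i] by linarith
      show "0 < - f m0" using False nz[of m0] by auto
    qed (use nz in auto)
    then show ?thesis by simp
  qed
qed

section \<open>Local times under shifts and truncation\<close>

lemma count_list_map_shift: "count_list (map (\<lambda>x. x + n) g) (u + n) = count_list g (u :: int)"
  by (induction g) auto

lemma count_list_eq_0: "set h \<subseteq> {..L} \<Longrightarrow> L < u \<Longrightarrow> count_list h (u :: int) = 0"
  by (auto simp: count_list_0_iff)

lemma count_list_le_filter: "Q u \<Longrightarrow> count_list g u \<le> length (filter Q g)"
  by (induction g) auto

lemma length_filter_hist: "length (filter Q (hist X t \<omega>)) = card {i. i \<le> t \<and> Q (X i \<omega>)}"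
proof (induction t)
  case (Suc t)
  have "{i. i \<le> Suc t \<and> Q (X i \<omega>)} =
      (if Q (X (Suc t) \<omega>) then insert (Suc t) {i. i \<le> t \<and> Q (X i \<omega>)} else {i. i \<le> t \<and> Q (X i \<omega>)})"
    by (auto simp: le_Suc_eq)
  then show ?case using Suc by simp
next
  case 0
  have "{i. i \<le> 0 \<and> Q (X i \<omega>)} = (if Q (X 0 \<omega>) then {0} else {})" by auto
  then show ?case by simp
qed

lemma count_trunc_hist_mono:
  "i \<le> t \<Longrightarrow> count_list (trunc n (hist X i \<omega>)) x \<le> count_list (trunc n (hist X t \<omega>)) x"
proof (induction t)
  case (Suc t)
  have "count_list (trunc n (hist X t \<omega>)) x \<le> count_list (trunc n (hist X (Suc t) \<omega>)) x"
    by (auto simp: trunc_eq)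
  then show ?case using Suc by (cases "i = Suc t") auto
qed auto

context vrrw_weight
begin

lemma path_wt_le_1: "path_wt w h \<le> 1"
  by (induction h rule: induct_list012)
    (auto intro!: mult_le_one simp: step_prob_le_1 step_prob_nonneg path_wt_nonneg)

text \<open>A nonzero probability under \<open>h\<close> makes \<open>y\<close> a neighbour of
  \<open>hd h\<close>, so \<open>y + n\<close> is a neighbour of \<open>hd h'\<close>; the local
  times around \<open>hd h'\<close> are at most \<open>K\<close>.\<close>

lemma step_prob_ge:
  assumes "step_prob w h y \<noteq> 0" "hd h' = hd h + n"
    and "\<And>u. u \<in> {hd h - 1, hd h + 1} \<Longrightarrow> count_list h' (u + n) \<le> K"
    and "\<And>i j. i \<le> K \<Longrightarrow> j \<le> K \<Longrightarrow> \<delta> \<le> w i / (w i + w j)"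
  shows "\<delta> \<le> step_prob w h' (y + n)"
proof -
  have "y = hd h + 1 \<or> y = hd h - 1" using assms(1) by (auto simp: step_prob_def Let_def split: if_splits)
  moreover have "count_list h' (hd h + n - 1) \<le> K" "count_list h' (hd h + n + 1) \<le> K"
    using assms(3)[of "hd h - 1"] assms(3)[of "hd h + 1"] by (simp_all add: algebra_simps)
  moreover have "step_prob w h' (hd h' + 1) = w (count_list h' (hd h' + 1)) /
      (w (count_list h' (hd h' + 1)) + w (count_list h' (hd h' - 1)))"
    by (simp add: step_prob_def Let_def add.commute)
  moreover have "step_prob w h' (hd h' - 1) = w (count_list h' (hd h' - 1)) /
      (w (count_list h' (hd h' - 1)) + w (count_list h' (hd h' + 1)))"
    by (simp add: step_prob_def Let_def)
  ultimately have "\<delta> \<le> step_prob w h' (hd h' + 1)" "\<delta> \<le> step_prob w h' (hd h' - 1)"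
    using assms(2,4) by auto
  moreover have "y + n = hd h' + 1 \<or> y + n = hd h' - 1"
    using \<open>y = hd h + 1 \<or> y = hd h - 1\<close> assms(2) by auto
  ultimately show ?thesis by auto
qed

text \<open>Far to the right of the prefixes the two walks have the same transition probabilities; near
  the prefixes only boundedly many steps are made, and each has probability at least \<open>\<delta>\<close>.\<close>
lemma path_wt_shift_ge:
  assumes p: "p \<noteq> []" "hd p = 0" "set p \<subseteq> {..L}" "0 \<le> L"
    and a: "a \<noteq> []" "hd a = n" "set a \<subseteq> {..n}" "count_list a (n - 1) \<le> K" "count_list a n \<le> K"
    and \<delta>: "0 \<le> \<delta>" "\<And>i j. i \<le> K + N \<Longrightarrow> j \<le> K + N \<Longrightarrow> \<delta> \<le> w i / (w i + w j)"
    and g: "set g \<subseteq> {1..}" "length (filter (\<lambda>x. x \<le> L + 2) g) \<le> N"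
  shows "\<delta> ^ length (filter (\<lambda>x. x \<le> L + 1) (tl (g @ [0]))) * path_wt w a * path_wt w (g @ p)
    \<le> path_wt w (map (\<lambda>x. x + n) g @ a) * path_wt w p"
  using g
proof (induction g)
  case Nil
  then show ?case by simp
next
  case (Cons y g)
  define z where "z = hd (g @ p)"
  define H where "H = g @ p"
  define H' where "H' = map (\<lambda>x. x + n) g @ a"
  \<comment> \<open>The exponent of \<open>\<delta>\<close> charges steps by their starting sites:
    for the path extended by \<open>y\<close> these are the entries of \<open>g @ [0]\<close>, where
    0 stands for \<open>hd p\<close>.\<close>
  have zg: "g @ [0] = z # tl (g @ [0])" using p(2) by (cases g) (auto simp: z_def)
  have hdH: "hd H = z" "H \<noteq> []" using p(1) by (auto simp: H_def z_def)
  have hdH': "hd H' = z + n" "H' \<noteq> []"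
    using p(1,2) a(1,2) by (cases g; auto simp: H'_def z_def)+
  have z0: "0 \<le> z" using Cons.prems(1) p(2) by (cases g) (auto simp: z_def)
  have IH: "\<delta> ^ length (filter (\<lambda>x. x \<le> L + 1) (tl (g @ [0]))) * path_wt w a * path_wt w H
      \<le> path_wt w H' * path_wt w p"
    using Cons by (auto simp: H_def H'_def split: if_splits)
  have cH: "count_list H u = count_list g u + count_list p u" for u
    by (simp add: H_def)
  have cH': "count_list H' (u + n) = count_list g u + count_list a (u + n)" for u
    by (simp add: H'_def count_list_map_shift)
  have step: "(if z \<le> L + 1 then \<delta> else 1) * step_prob w H y \<le> step_prob w H' (y + n)"
  \<comment> \<open>From a site beyond \<open>L + 1\<close>, both neighbours avoid \<open>p\<close>
    and their shifts avoid \<open>a\<close>, so the local times agree.\<close>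
  proof (cases "z \<le> L + 1")
    case False
    have "count_list H' (u + n) = count_list H u" if "L < u" for u
      using count_list_eq_0[OF p(3) that] count_list_eq_0[OF a(3), of "u + n"] that p(4) by (simp add: cH cH')
    from this[of "z - 1"] this[of "z + 1"] False
    have "count_list H' (z + n - 1) = count_list H (z - 1)" "count_list H' (z + n + 1) = count_list H (z + 1)"
      by (simp_all add: algebra_simps)
    then have "step_prob w H' (y + n) = step_prob w H y"
      unfolding step_prob_def Let_def hdH hdH' by (auto simp: algebra_simps)
    then show ?thesis using False by simp
  next
    case True
    show ?thesis
    proof (cases "step_prob w H y = 0")
      case True
      then show ?thesis by (simp add: step_prob_nonneg)
    next
      case False
      have "\<delta> \<le> step_prob w H' (y + n)"
      proof (rule step_prob_ge[OF False, where K = "K + N"])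
        fix u assume u: "u \<in> {hd H - 1, hd H + 1}"
        have ca: "count_list a (u + n) \<le> K"
        proof -
          \<comment> \<open>The neighbours of \<open>z\<close> are at least -1. The sites -1 and 0
            are shifted to \<open>n - 1\<close> and \<open>n\<close>, positive ones to sites that
            \<open>a\<close> never visits.\<close>
          consider "u = -1" | "u = 0" | "u > 0" using u z0 hdH by force
          then show ?thesis
          proof cases
            case 3
            then show ?thesis using count_list_eq_0[OF a(3), of "u + n"] by simp
          qed (use a(4,5) in \<open>auto simp: add.commute\<close>)
        qed
        have cg: "count_list g u \<le> N"
        proof -
          \<comment> \<open>The neighbours of \<open>z\<close> reach up to \<open>L + 2\<close>,
            which explains the threshold in the bound on visits.\<close>
          have "count_list g u \<le> length (filter (\<lambda>x. x \<le> L + 2) g)"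
            by (rule count_list_le_filter) (use u hdH \<open>z \<le> L + 1\<close> in auto)
          also have "\<dots> \<le> N" using Cons.prems(2) by (auto split: if_splits)
          finally show ?thesis .
        qed
        show "count_list H' (u + n) \<le> K + N" unfolding cH' using ca cg by simp
      qed (use hdH hdH' \<delta> in auto)
      moreover have "\<delta> * step_prob w H y \<le> \<delta> * 1"
        using \<delta>(1) step_prob_le_1 by (intro mult_left_mono) auto
      ultimately show ?thesis using \<open>z \<le> L + 1\<close> by simp
    qed
  qed
  have wtH: "path_wt w (y # H) = step_prob w H y * path_wt w H" using hdH(2) by (cases H) auto
  have wtH': "path_wt w ((y + n) # H') = step_prob w H' (y + n) * path_wt w H'"
    using hdH'(2) by (cases H') auto
  let ?e = "length (filter (\<lambda>x. x \<le> L + 1) (tl (g @ [0])))"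
  have "\<delta> ^ length (filter (\<lambda>x. x \<le> L + 1) (g @ [0])) = (if z \<le> L + 1 then \<delta> else 1) * \<delta> ^ ?e"
    by (subst zg) simp
  then have "\<delta> ^ length (filter (\<lambda>x. x \<le> L + 1) (tl ((y # g) @ [0]))) * path_wt w a * path_wt w ((y # g) @ p)
     = ((if z \<le> L + 1 then \<delta> else 1) * step_prob w H y) * (\<delta> ^ ?e * path_wt w a * path_wt w H)"
    using wtH by (simp add: H_def)
  also have "\<dots> \<le> step_prob w H' (y + n) * (path_wt w H' * path_wt w p)"
    by (intro mult_mono[OF step IH] mult_nonneg_nonneg zero_le_power step_prob_nonneg path_wt_nonneg \<delta>(1))
  also have "\<dots> = path_wt w (map (\<lambda>x. x + n) (y # g) @ a) * path_wt w p"
    using wtH' by (simp add: H'_def)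
  finally show ?case .
qed

end

section \<open>Tightness and the dichotomy\<close>

context vrrw
begin

lemma pred_hist: "Measurable.pred M (\<lambda>\<omega>. P (hist X t \<omega>))"
  using sets_hist by (simp add: pred_def)

lemma pred_X: "Measurable.pred M (\<lambda>\<omega>. P (X i \<omega>))"
  using pred_hist[of "\<lambda>h. P (hd h)" i] by simp

lemma AE_nearest_neighbour: "AE \<omega> in M. X 0 \<omega> = 0 \<and> (\<forall>i. \<bar>X (Suc i) \<omega> - X i \<omega>\<bar> \<le> 1)"
proof (rule AE_mp[OF AE_hist_paths], intro AE_I2 impI conjI allI)
  fix \<omega> i assume h: "\<forall>t. hist X t \<omega> \<in> paths t"
  from h have "hist X 0 \<omega> \<in> paths 0" by blast
  then show "X 0 \<omega> = 0" by simp
  from h have "hist X (Suc i) \<omega> \<in> paths (Suc i)" by blast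
  then show "\<bar>X (Suc i) \<omega> - X i \<omega>\<bar> \<le> 1" by auto
qed

lemma prob_ex_le:
  fixes P :: "nat \<Rightarrow> 'a \<Rightarrow> bool"
  assumes "\<And>t. Measurable.pred M (P t)" "\<And>i t \<omega>. i \<le> t \<Longrightarrow> P i \<omega> \<Longrightarrow> P t \<omega>"
    and "\<And>t. prob {\<omega> \<in> space M. P t \<omega>} \<le> \<epsilon>"
  shows "prob {\<omega> \<in> space M. \<exists>t. P t \<omega>} \<le> \<epsilon>"
proof -
  let ?E = "\<lambda>t. {\<omega> \<in> space M. P t \<omega>}"
  have "(\<lambda>t. prob (?E t)) \<longlonglongrightarrow> prob (\<Union>t. ?E t)"
    using assms(1,2) by (intro finite_Lim_measure_incseq) (auto simp: pred_def incseq_def)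
  then have "prob (\<Union>t. ?E t) \<le> \<epsilon>"
    using assms(3) by (intro LIMSEQ_le_const2) auto
  moreover have "(\<Union>t. ?E t) = {\<omega> \<in> space M. \<exists>t. P t \<omega>}" by auto
  ultimately show ?thesis by simp
qed

text \<open>Markov's inequality for the crossing moments of the two edges at
  \<open>n - int j\<close>, whose bounds depend neither on \<open>n\<close> nor on
  \<open>t\<close>.\<close>

lemma tight_local_time_before_hitting:
  assumes "0 < \<epsilon>" "1 \<le> j"
  shows "\<exists>K. \<forall>n. prob {\<omega> \<in> space M. \<exists>t. K \<le> count_list (trunc n (hist X t \<omega>)) (n - int j)} \<le> \<epsilon>"
proof -
  obtain \<Lambda> where \<Lambda>: "1 \<le> \<Lambda>" and bound:
    "\<And>n t i. path_exp w t (\<lambda>h. real (up (n - 1 - int i) (trunc n h)) powr (1 - \<alpha>)) \<le> 8 * (2 * \<Lambda>) ^ i"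
    by (rule path_exp_up_bounded) blast
  define D where "D = 8 * (2 * \<Lambda>) ^ j + 8 * (2 * \<Lambda>) ^ (j - 1)"
  have D: "0 < D" unfolding D_def using \<Lambda> by (intro add_pos_pos mult_pos_pos zero_less_power) auto
  \<comment> \<open>\<open>R\<close> solves \<open>D / R powr (1 - \<alpha>) = \<epsilon>\<close>,
    with \<open>D\<close> the sum of the bounds for the two edges.\<close>
  define R where "R = (D / \<epsilon>) powr (1 / (1 - \<alpha>))"
  define K where "K = Suc (nat \<lceil>R\<rceil>)"
  have RK: "R \<le> real K" unfolding K_def by linarith
  have "R powr (1 - \<alpha>) \<le> real K powr (1 - \<alpha>)"
    using RK \<alpha> by (intro powr_mono2) (auto simp: R_def)
  moreover have "R powr (1 - \<alpha>) = D / \<epsilon>" unfolding R_def using \<alpha> D \<open>0 < \<epsilon>\<close> by (simp add: powr_powr)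
  ultimately have DK: "D / real K powr (1 - \<alpha>) \<le> \<epsilon>"
    using \<open>0 < \<epsilon>\<close> by (simp add: K_def divide_simps mult.commute)
  \<comment> \<open>Visits come from upward crossings of the left edge and downward crossings of the
    right edge; the latter exceed its upward crossings by at most one. Allowing for a visit at time
    0, a local time of \<open>2 * K + 2\<close> forces \<open>K\<close> upward crossings of one
    edge.\<close>
  have "prob {\<omega> \<in> space M. 2 * K + 2 \<le> count_list (trunc n (hist X t \<omega>)) (n - int j)} \<le> \<epsilon>" for n t
  proof -
    let ?x = "n - int j"
    let ?U = "\<lambda>x h. real (up x (trunc n h)) powr (1 - \<alpha>)"
    have "prob {\<omega> \<in> space M. 2 * K + 2 \<le> count_list (trunc n (hist X t \<omega>)) ?x}
        \<le> path_exp w t (\<lambda>h. (1 / real K powr (1 - \<alpha>)) * (?U (?x - 1) h + ?U ?x h))"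
    proof (rule prob_hist_le_path_exp[where P = "\<lambda>h. 2 * K + 2 \<le> count_list (trunc n h) ?x"])
      fix h assume h: "h \<in> paths t" "2 * K + 2 \<le> count_list (trunc n h) ?x"
      obtain s where s: "trunc n h \<in> paths s" using trunc_paths h(1) by blast
      have "K \<le> up (?x - 1) (trunc n h) \<or> K \<le> up ?x (trunc n h)"
        using h(2) count_list_eq_crossings[OF s, of ?x] up_minus_down[OF s, of ?x]
        by (auto split: if_splits)
      then have "real K powr (1 - \<alpha>) \<le> ?U (?x - 1) h \<or> real K powr (1 - \<alpha>) \<le> ?U ?x h"
        using \<alpha> by (auto intro!: powr_mono2)
      then have "real K powr (1 - \<alpha>) \<le> ?U (?x - 1) h + ?U ?x h"
        by (auto intro: add_increasing add_increasing2)
      then show "1 \<le> 1 / real K powr (1 - \<alpha>) * (?U (?x - 1) h + ?U ?x h)"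
        by (simp add: K_def divide_simps)
    qed auto
    also have "\<dots> = (1 / real K powr (1 - \<alpha>)) * (path_exp w t (?U (?x - 1)) + path_exp w t (?U ?x))"
      by (simp only: path_exp_cmult path_exp_add)
    also have "\<dots> \<le> (1 / real K powr (1 - \<alpha>)) * D"
    proof -
      have e1: "?x - 1 = n - 1 - int j" by simp
      have e2: "?x = n - 1 - int (j - 1)" using \<open>1 \<le> j\<close> by auto
      have "path_exp w t (?U (?x - 1)) \<le> 8 * (2 * \<Lambda>) ^ j" unfolding e1 by (rule bound)
      moreover have "path_exp w t (?U ?x) \<le> 8 * (2 * \<Lambda>) ^ (j - 1)" unfolding e2 by (rule bound)
      ultimately show ?thesis unfolding D_def by (intro mult_left_mono add_mono) auto
    qed
    finally show ?thesis using DK by simp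
  qed
  then have "prob {\<omega> \<in> space M. \<exists>t. 2 * K + 2 \<le> count_list (trunc n (hist X t \<omega>)) (n - int j)} \<le> \<epsilon>" for n
    by (intro prob_ex_le pred_hist) (blast intro: count_trunc_hist_mono order_trans)+
  then show ?thesis by blast
qed

text \<open>If \<open>n\<close> is never hit, truncation changes nothing, and infinitely many visits
  to \<open>n - int j\<close> exceed every bound supplied by tightness.\<close>

lemma AE_not_io_if_never_hit:
  assumes "1 \<le> j"
  shows "AE \<omega> in M. (\<forall>i. X i \<omega> \<noteq> n) \<longrightarrow> \<not> (\<exists>\<^sub>\<infinity>i. X i \<omega> = n - int j)"
proof -
  note [measurable] = pred_X
  define B where "B = {\<omega> \<in> space M. (\<forall>i. X i \<omega> \<noteq> n) \<and> (\<exists>\<^sub>\<infinity>i. X i \<omega> = n - int j)}"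
  have meas: "B \<in> sets M" unfolding B_def INFM_nat by measurable
  have "prob B \<le> \<epsilon>" if \<epsilon>: "0 < \<epsilon>" for \<epsilon>
  proof -
    obtain K where K: "prob {\<omega> \<in> space M. \<exists>t. K \<le> count_list (trunc n (hist X t \<omega>)) (n - int j)} \<le> \<epsilon>"
      using tight_local_time_before_hitting[OF \<epsilon> assms] by blast
    have "B \<subseteq> {\<omega> \<in> space M. \<exists>t. K \<le> count_list (trunc n (hist X t \<omega>)) (n - int j)}"
      unfolding B_def
    proof safe
      fix \<omega> assume "\<forall>i. X i \<omega> \<noteq> n" and io: "\<exists>\<^sub>\<infinity>i. X i \<omega> = n - int j"
      then have "trunc n (hist X t \<omega>) = hist X t \<omega>" for t
        by (intro trunc_eq) (auto simp: set_hist)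
      then show "\<exists>t. K \<le> count_list (trunc n (hist X t \<omega>)) (n - int j)"
        using count_list_hist_unbounded[where X = X and \<omega> = \<omega> and x = "n - int j"] io by simp
    qed
    moreover have "{\<omega> \<in> space M. \<exists>t. K \<le> count_list (trunc n (hist X t \<omega>)) (n - int j)} \<in> sets M"
      by (intro sets.sets_Collect_countable_Ex sets_hist)
    ultimately have "prob B \<le> prob {\<omega> \<in> space M. \<exists>t. K \<le> count_list (trunc n (hist X t \<omega>)) (n - int j)}"
      by (rule finite_measure_mono)
    then show ?thesis using K by linarith
  qed
  then have "prob B \<le> 0" by - (rule field_le_epsilon, simp)
  then have "prob B = 0" by (simp add: measure_le_0_iff)
  then have "AE \<omega> in M. \<omega> \<notin> B" using meas by (simp add: prob_eq_0)
  then show ?thesis by (rule AE_mp) (auto intro!: AE_I2 simp: B_def)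
qed

text \<open>A site visited infinitely often forces hits of all sites to its right by
  \<open>AE_not_io_if_never_hit\<close>, and to its left by the same lemma for the reflected walk.
  Then \<open>hits_io_if_unbounded\<close> applies.\<close>

lemma AE_io_all_or_none:
  "AE \<omega> in M. (\<exists>x. \<exists>\<^sub>\<infinity>i. X i \<omega> = x) \<longrightarrow> (\<forall>y. \<exists>\<^sub>\<infinity>i. X i \<omega> = y)"
proof -
  interpret R: vrrw w \<alpha> c C M "\<lambda>n \<omega>. - X n \<omega>" by (rule vrrw_reflected)
  have up: "AE \<omega> in M. \<forall>n j. 1 \<le> j \<longrightarrow> (\<forall>i. X i \<omega> \<noteq> n) \<longrightarrow> \<not> (\<exists>\<^sub>\<infinity>i. X i \<omega> = n - int j)"
    unfolding AE_all_countable using AE_not_io_if_never_hit by auto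
  have down: "AE \<omega> in M. \<forall>n j. 1 \<le> j \<longrightarrow> (\<forall>i. - X i \<omega> \<noteq> n) \<longrightarrow> \<not> (\<exists>\<^sub>\<infinity>i. - X i \<omega> = n - int j)"
    unfolding AE_all_countable using R.AE_not_io_if_never_hit by auto
  from up down AE_nearest_neighbour show ?thesis
  proof (eventually_elim, intro impI allI)
    fix \<omega> y
    assume u: "\<forall>n j. 1 \<le> j \<longrightarrow> (\<forall>i. X i \<omega> \<noteq> n) \<longrightarrow> \<not> (\<exists>\<^sub>\<infinity>i. X i \<omega> = n - int j)"
      and d: "\<forall>n j. 1 \<le> j \<longrightarrow> (\<forall>i. - X i \<omega> \<noteq> n) \<longrightarrow> \<not> (\<exists>\<^sub>\<infinity>i. - X i \<omega> = n - int j)"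
      and nn: "X 0 \<omega> = 0 \<and> (\<forall>i. \<bar>X (Suc i) \<omega> - X i \<omega>\<bar> \<le> 1)"
      and "\<exists>x. \<exists>\<^sub>\<infinity>i. X i \<omega> = x"
    then obtain x where x: "\<exists>\<^sub>\<infinity>i. X i \<omega> = x" by blast
    have "\<exists>i. X i \<omega> = n" for n
    proof (cases n x rule: linorder_cases)
      case equal
      then show ?thesis using x by (auto dest: INFM_EX)
    next
      case greater
      then have "1 \<le> nat (n - x)" "n - int (nat (n - x)) = x" by auto
      then show ?thesis using u x by metis
    next
      case less
      then have "1 \<le> nat (x - n)" "- n - int (nat (x - n)) = - x" by auto
      moreover have "\<exists>\<^sub>\<infinity>i. - X i \<omega> = - x" using x by simp
      ultimately have "\<exists>i. - X i \<omega> = - n" using d by metis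
      then show ?thesis by simp
    qed
    then show "\<exists>\<^sub>\<infinity>i. X i \<omega> = y"
      using nn x hits_io_if_unbounded[of "\<lambda>i. X i \<omega>" x y] by blast
  qed
qed

section \<open>Escape to the right from a fresh environment\<close>

text \<open>In use, \<open>p\<close> is the history up to the last visit to 0, and \<open>N\<close>
  bounds the time spent in the region where transition probabilities may still feel
  \<open>p\<close>. Inserting 0 keeps the maximum nonnegative.\<close>

definition escape_event :: "int list \<Rightarrow> nat \<Rightarrow> 'a set" where
  "escape_event p N = {\<omega> \<in> space M. hist X (length p - 1) \<omega> = p \<and> (\<forall>i\<ge>length p. X i \<omega> \<ge> 1) \<and>
     (\<forall>t. length (filter (\<lambda>x. x \<le> Max (insert 0 (set p)) + 2) (hist X t \<omega>)) \<le> N)}"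

lemma sets_escape_event: "escape_event p N \<in> sets M"
proof -
  note [measurable] = pred_X pred_hist[of "\<lambda>h. h = p"]
    pred_hist[of "\<lambda>h. length (filter (\<lambda>x. x \<le> Max (insert 0 (set p)) + 2) h) \<le> N"]
  show ?thesis unfolding escape_event_def by measurable
qed

text \<open>There are countably many pairs of \<open>p\<close> and \<open>N\<close>, and almost
  every path tending to the right lies in one of their events.\<close>

lemma escape_event_exists:
  assumes "\<not> (AE \<omega> in M. \<not> (\<forall>k. \<exists>m. \<forall>i\<ge>m. X i \<omega> > k))"
  shows "\<exists>p N. p \<noteq> [] \<and> hd p = 0 \<and> prob (escape_event p N) > 0"
proof (rule ccontr)
  assume "\<not> ?thesis"
  then have zero: "prob (escape_event p N) = 0" if "p \<noteq> []" "hd p = 0" for p N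
    using that by (auto simp: not_less measure_le_0_iff)
  have "AE \<omega> in M. p \<noteq> [] \<longrightarrow> hd p = 0 \<longrightarrow> \<omega> \<notin> escape_event p N" for p N
    using zero[of p N] by (cases "p \<noteq> [] \<and> hd p = 0") (auto simp: prob_eq_0 sets_escape_event)
  then have "AE \<omega> in M. \<forall>p N. p \<noteq> [] \<longrightarrow> hd p = 0 \<longrightarrow> \<omega> \<notin> escape_event p N"
    by (simp add: AE_all_countable)
  with AE_nearest_neighbour AE_space have "AE \<omega> in M. \<not> (\<forall>k. \<exists>m. \<forall>i\<ge>m. X i \<omega> > k)"
  proof eventually_elim
    fix \<omega> assume nn: "X 0 \<omega> = 0 \<and> (\<forall>i. \<bar>X (Suc i) \<omega> - X i \<omega>\<bar> \<le> 1)" and sp: "\<omega> \<in> space M"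
      and none: "\<forall>p N. p \<noteq> [] \<longrightarrow> hd p = 0 \<longrightarrow> \<omega> \<notin> escape_event p N"
    show "\<not> (\<forall>k. \<exists>m. \<forall>i\<ge>m. X i \<omega> > k)"
    proof
      assume tr: "\<forall>k. \<exists>m. \<forall>i\<ge>m. X i \<omega> > k"
      have fin: "finite {i. X i \<omega> \<le> k}" for k
      proof -
        obtain m where "\<forall>i\<ge>m. X i \<omega> > k" using tr by blast
        then have "{i. X i \<omega> \<le> k} \<subseteq> {..<m}" by (force simp: not_less[symmetric])
        then show ?thesis by (rule finite_subset) simp
      qed
      \<comment> \<open>The last time at or below 0. The next position is at least 1 and steps have
        size at most one, so \<open>X r \<omega> = 0\<close>.\<close>
      define r where "r = Max {i. X i \<omega> \<le> 0}"
      have "0 \<in> {i. X i \<omega> \<le> 0}" using nn by simp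
      then have ne: "{i. X i \<omega> \<le> 0} \<noteq> {}" by blast
      have r_in: "X r \<omega> \<le> 0" using Max_in[OF fin ne] by (simp add: r_def)
      have after: "X i \<omega> \<ge> 1" if "i > r" for i
      proof (rule ccontr)
        assume "\<not> X i \<omega> \<ge> 1"
        then have "i \<le> r" unfolding r_def by (intro Max_ge fin) auto
        then show False using that by simp
      qed
      have "X r \<omega> = 0"
        using after[of "Suc r"] r_in nn[THEN conjunct2, rule_format, of r] by linarith
      moreover define p where "p = hist X r \<omega>"
      define N where "N = card {i. X i \<omega> \<le> Max (insert 0 (set p)) + 2}"
      have "length (filter (\<lambda>x. x \<le> Max (insert 0 (set p)) + 2) (hist X t \<omega>)) \<le> N" for t
        unfolding length_filter_hist N_def by (intro card_mono fin) auto
      then have "\<omega> \<in> escape_event p N"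
        using sp after unfolding escape_event_def by (simp add: p_def)
      ultimately show False using none by (simp add: p_def)
    qed
  qed
  with assms show False by contradiction
qed

text \<open>The escaping continuations of one fixed prefix \<open>p\<close> are translated by
  \<open>n\<close> and attached to \<open>a\<close>. At most \<open>Suc N\<close> steps cost a
  factor \<open>\<delta>\<close>, so \<open>\<kappa>\<close> depends on \<open>K\<close> but not on
  \<open>a\<close> or \<open>n\<close>.\<close>

lemma uniform_escape:
  assumes "\<not> (AE \<omega> in M. \<not> (\<forall>k. \<exists>m. \<forall>i\<ge>m. X i \<omega> > k))"
  obtains \<kappa> where "0 < \<kappa>"
    "\<And>a n. a \<noteq> [] \<Longrightarrow> hd a = n \<Longrightarrow> set a \<subseteq> {..n} \<Longrightarrow> count_list a (n - 1) \<le> K \<Longrightarrow> count_list a n \<le> K \<Longrightarrow>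
      \<kappa> * path_wt w a \<le> prob {\<omega> \<in> space M. hist X (length a - 1) \<omega> = a \<and> (\<forall>i\<ge>length a. X i \<omega> > n)}"
proof -
  obtain p N where p: "p \<noteq> []" "hd p = 0" "prob (escape_event p N) > 0"
    using escape_event_exists[OF assms] by blast
  define L where "L = Max (insert 0 (set p))"
  define \<eta> where "\<eta> = prob (escape_event p N)"
  have L: "set p \<subseteq> {..L}" "0 \<le> L" unfolding L_def by auto
  let ?I = "{..K + N} \<times> {..K + N}"
  \<comment> \<open>The least transition probability with neighbouring local times up to
    \<open>K + N\<close>.\<close>
  define \<delta> where "\<delta> = Min ((\<lambda>(i, j). w i / (w i + w j)) ` ?I)"
  have \<delta>_le: "\<delta> \<le> w i / (w i + w j)" if "i \<le> K + N" "j \<le> K + N" for i j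
    unfolding \<delta>_def using that by (intro Min_le) (auto intro!: rev_image_eqI[of "(i, j)"])
  have "\<delta> \<in> (\<lambda>(i, j). w i / (w i + w j)) ` ?I" unfolding \<delta>_def by (intro Min_in) auto
  then have \<delta>_pos: "0 < \<delta>" using w_pos by (auto intro!: divide_pos_pos add_pos_pos)
  have "\<delta> \<le> w 0 / (w 0 + w 0)" by (rule \<delta>_le) auto
  then have \<delta>_1: "\<delta> \<le> 1" using w_pos[of 0] by simp
  define r where "r = length p - 1"
  have lp: "length p = Suc r" using p(1) by (cases p) (auto simp: r_def)
  have "\<delta> ^ Suc N * \<eta> * path_wt w a
      \<le> prob {\<omega> \<in> space M. hist X (length a - 1) \<omega> = a \<and> (\<forall>i\<ge>length a. X i \<omega> > n)}"
    if a: "a \<noteq> []" "hd a = n" "set a \<subseteq> {..n}" "count_list a (n - 1) \<le> K" "count_list a n \<le> K" for a n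
  proof -
    define s where "s = length a - 1"
    have la: "length a = Suc s" using a(1) by (cases a) (auto simp: s_def)
    \<comment> \<open>Escape is first estimated over \<open>m\<close> more steps; the bound is
      uniform in \<open>m\<close> and survives the decreasing limit.\<close>
    define F where "F m = {\<omega> \<in> space M. hist X s \<omega> = a \<and> (\<forall>i. length a \<le> i \<longrightarrow> i \<le> s + m \<longrightarrow> X i \<omega> > n)}" for m
    have F_sets: "F m \<in> sets M" for m
    proof -
      note [measurable] = pred_X pred_hist[of "\<lambda>h. h = a"]
      show ?thesis unfolding F_def by measurable
    qed
    have F_ge: "\<delta> ^ Suc N * \<eta> * path_wt w a \<le> prob (F m)" for m
    proof -
      define G where "G = {g. length g = m \<and> set g \<subseteq> {1..} \<and>
        length (filter (\<lambda>x. x \<le> L + 2) g) \<le> N \<and> g @ p \<in> paths (r + m)}"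
      define A where "A = (\<lambda>g. g @ p) ` G"
      define A' where "A' = (\<lambda>g. map (\<lambda>x. x + n) g @ a) ` G"
      have inj: "inj_on (\<lambda>g. g @ p) G" "inj_on (\<lambda>g. map (\<lambda>x. x + n) g @ a) G"
        by (auto simp: inj_on_def inj_map_eq_map[of "\<lambda>x. x + n", unfolded inj_on_def])
      have "A \<subseteq> paths (r + m)" by (auto simp: A_def G_def)
      then have finA: "finite A" using finite_paths finite_subset by blast
      then have finG: "finite G" unfolding A_def using finite_imageD inj(1) by blast
      have "\<eta> \<le> prob {\<omega> \<in> space M. hist X (r + m) \<omega> \<in> A}"
        unfolding \<eta>_def
      proof (rule finite_measure_mono_AE)
        show "AE \<omega> in M. \<omega> \<in> escape_event p N \<longrightarrow> \<omega> \<in> {\<omega> \<in> space M. hist X (r + m) \<omega> \<in> A}"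
        proof (rule AE_mp[OF AE_hist_paths], intro AE_I2 impI)
          fix \<omega> assume sp: "\<omega> \<in> space M" and paths: "\<forall>t. hist X t \<omega> \<in> paths t" and e: "\<omega> \<in> escape_event p N"
          obtain g where g: "hist X (r + m) \<omega> = g @ hist X r \<omega>" "length g = m"
              "set g = (\<lambda>i. X i \<omega>) ` {r<..r + m}"
            using hist_append[of X r m \<omega>] by blast
          from e have hr: "hist X r \<omega> = p" by (simp add: escape_event_def r_def)
          from e have "length (filter (\<lambda>x. x \<le> L + 2) (hist X (r + m) \<omega>)) \<le> N"
            by (simp add: escape_event_def L_def)
          then have "length (filter (\<lambda>x. x \<le> L + 2) g) \<le> N" using g(1) by simp
          moreover have "set g \<subseteq> {1..}" using e g(3) lp by (auto simp: escape_event_def)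
          moreover have "g @ p \<in> paths (r + m)" using paths g(1) hr by metis
          ultimately have "g \<in> G" using g(2) by (simp add: G_def)
          then show "\<omega> \<in> {\<omega> \<in> space M. hist X (r + m) \<omega> \<in> A}" using sp g(1) hr by (auto simp: A_def)
        qed
      qed (rule sets_hist)
      also have "\<dots> = (\<Sum>h\<in>A. path_wt w h)"
        using finA \<open>A \<subseteq> paths (r + m)\<close> paths_length by (intro prob_hist_finite) auto
      also have "\<dots> = (\<Sum>g\<in>G. path_wt w (g @ p))"
        unfolding A_def by (subst sum.reindex[OF inj(1)]) simp
      finally have \<eta>_le: "\<eta> \<le> (\<Sum>g\<in>G. path_wt w (g @ p))" .
      have "\<delta> ^ Suc N * \<eta> * path_wt w a \<le> \<delta> ^ Suc N * (\<Sum>g\<in>G. path_wt w (g @ p)) * path_wt w a"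
        using \<eta>_le \<delta>_pos by (intro mult_right_mono mult_left_mono) (auto simp: path_wt_nonneg)
      also have "\<dots> = (\<Sum>g\<in>G. \<delta> ^ Suc N * path_wt w a * path_wt w (g @ p))"
        by (simp add: sum_distrib_left sum_distrib_right mult_ac)
      also have "\<dots> \<le> (\<Sum>g\<in>G. path_wt w (map (\<lambda>x. x + n) g @ a))"
      proof (rule sum_mono)
        fix g assume g: "g \<in> G"
        let ?e = "length (filter (\<lambda>x. x \<le> L + 1) (tl (g @ [0])))"
        have "length (filter (\<lambda>x. x \<le> L + 1) g) \<le> length (filter (\<lambda>x. x \<le> L + 2) g)"
          by (induction g) auto
        \<comment> \<open>The extra one accounts for the step that leaves 0, the head of
          \<open>p\<close>.\<close>
        moreover have "?e \<le> Suc (length (filter (\<lambda>x. x \<le> L + 1) g))"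
          by (cases g) auto
        ultimately have "?e \<le> Suc N" using g by (simp add: G_def)
        then have "\<delta> ^ Suc N \<le> \<delta> ^ ?e" using \<delta>_pos \<delta>_1 by (intro power_decreasing) auto
        then have "\<delta> ^ Suc N * path_wt w a * path_wt w (g @ p) \<le> \<delta> ^ ?e * path_wt w a * path_wt w (g @ p)"
          by (intro mult_right_mono path_wt_nonneg)
        also have "\<dots> \<le> path_wt w (map (\<lambda>x. x + n) g @ a) * path_wt w p"
          using g \<delta>_le \<delta>_pos by (intro path_wt_shift_ge[OF p(1,2) L a, where N = N]) (auto simp: G_def)
        also have "\<dots> \<le> path_wt w (map (\<lambda>x. x + n) g @ a) * 1"
          by (intro mult_left_mono path_wt_le_1 path_wt_nonneg)
        finally show "\<delta> ^ Suc N * path_wt w a * path_wt w (g @ p) \<le> path_wt w (map (\<lambda>x. x + n) g @ a)"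
          by simp
      qed
      also have "\<dots> = (\<Sum>h\<in>A'. path_wt w h)"
        unfolding A'_def by (subst sum.reindex[OF inj(2)]) simp
      also have "\<dots> = prob {\<omega> \<in> space M. hist X (s + m) \<omega> \<in> A'}"
        using finG la by (intro prob_hist_finite[symmetric]) (auto simp: A'_def G_def)
      also have "\<dots> \<le> prob (F m)"
      proof (rule finite_measure_mono[OF _ F_sets], safe)
        fix \<omega> assume sp: "\<omega> \<in> space M" and "hist X (s + m) \<omega> \<in> A'"
        then obtain g where g: "g \<in> G" "hist X (s + m) \<omega> = map (\<lambda>x. x + n) g @ a" by (auto simp: A'_def)
        obtain g' where g': "hist X (s + m) \<omega> = g' @ hist X s \<omega>" "length g' = m"
            "set g' = (\<lambda>i. X i \<omega>) ` {s<..s + m}"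
          using hist_append[of X s m \<omega>] by blast
        have eq: "g' = map (\<lambda>x. x + n) g" "hist X s \<omega> = a"
          using g g' by (auto simp: G_def)
        have "X i \<omega> > n" if "length a \<le> i" "i \<le> s + m" for i
        proof -
          have "X i \<omega> \<in> set g'" using that la by (auto simp: g'(3))
          then show ?thesis using g(1) by (auto simp: eq G_def)
        qed
        then show "\<omega> \<in> F m" using sp eq(2) by (simp add: F_def)
      qed
      finally show ?thesis .
    qed
    have "(\<lambda>m. prob (F m)) \<longlonglongrightarrow> prob (\<Inter>m. F m)"
      using F_sets by (intro finite_Lim_measure_decseq) (auto simp: F_def decseq_def)
    then have "\<delta> ^ Suc N * \<eta> * path_wt w a \<le> prob (\<Inter>m. F m)"
      using F_ge by (intro LIMSEQ_le_const) auto
    also have "(\<Inter>m. F m) = {\<omega> \<in> space M. hist X (length a - 1) \<omega> = a \<and> (\<forall>i\<ge>length a. X i \<omega> > n)}"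
      unfolding F_def s_def[symmetric] by (auto intro: le_add2)
    finally show ?thesis .
  qed
  moreover have "0 < \<delta> ^ Suc N * \<eta>" using \<delta>_pos p(3) by (simp add: \<eta>_def)
  ultimately show ?thesis using that by blast
qed

end

section \<open>The zero-one law\<close>

context vrrw
begin

text \<open>Suppose that returning to 0 infinitely often has probability \<open>\<rho> > 0\<close>.
  This event is nearly that of \<open>N\<close> visits to 0 by time \<open>m\<close>. On a large
  part of it the walk later hits a fresh level \<open>n\<close> with controlled local time at
  \<open>n - 1\<close>, and then escapes with conditional probability at least
  \<open>\<kappa>\<close>. So \<open>N\<close> visits without recurrence are more likely than the
  approximation allows.\<close>

lemma AE_not_io_if_escape_possible:
  assumes esc: "\<not> (AE \<omega> in M. \<not> (\<forall>k. \<exists>m. \<forall>i\<ge>m. X i \<omega> > k))"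
  shows "AE \<omega> in M. \<not> (\<exists>\<^sub>\<infinity>i. X i \<omega> = 0)"
proof (rule ccontr)
  assume nAE: "\<not> ?thesis"
  note [measurable] = pred_X
  define Rec where "Rec = {\<omega> \<in> space M. \<exists>\<^sub>\<infinity>i. X i \<omega> = 0}"
  have Rec_sets: "Rec \<in> sets M" unfolding Rec_def INFM_nat by measurable
  define \<rho> where "\<rho> = prob Rec"
  have "\<rho> \<noteq> 0"
  proof
    assume "\<rho> = 0"
    then have "AE \<omega> in M. \<omega> \<notin> Rec" using Rec_sets by (simp add: \<rho>_def prob_eq_0)
    then have "AE \<omega> in M. \<not> (\<exists>\<^sub>\<infinity>i. X i \<omega> = 0)"
      by (rule AE_mp) (auto intro!: AE_I2 simp: Rec_def)
    with nAE show False by contradiction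
  qed
  then have \<rho>: "0 < \<rho>" by (simp add: \<rho>_def zero_less_measure_iff)
  obtain K where K: "\<And>n. prob {\<omega> \<in> space M. \<exists>t. K \<le> count_list (trunc n (hist X t \<omega>)) (n - int 1)} \<le> \<rho> / 4"
    using tight_local_time_before_hitting[of "\<rho> / 4" 1] \<rho> by auto
  \<comment> \<open>Taking \<open>Suc K\<close> also covers the single visit to \<open>n\<close>,
    even if \<open>K\<close> is 0.\<close>
  obtain \<kappa> where \<kappa>: "0 < \<kappa>" and escape: "\<And>a n. a \<noteq> [] \<Longrightarrow> hd a = n \<Longrightarrow> set a \<subseteq> {..n} \<Longrightarrow>
      count_list a (n - 1) \<le> Suc K \<Longrightarrow> count_list a n \<le> Suc K \<Longrightarrow>
      \<kappa> * path_wt w a \<le> prob {\<omega> \<in> space M. hist X (length a - 1) \<omega> = a \<and> (\<forall>i\<ge>length a. X i \<omega> > n)}"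
    using uniform_escape[OF esc, of "Suc K"] by blast
  define E where "E N t = {\<omega> \<in> space M. N \<le> count_list (hist X t \<omega>) 0}" for N t
  define V where "V N = (\<Union>t. E N t)" for N
  have E_sets: "E N t \<in> sets M" for N t unfolding E_def by (rule sets_hist)
  have V_sets: "V N \<in> sets M" for N unfolding V_def using E_sets by auto
  have "(\<Inter>N. V N) = Rec"
  proof safe
    fix \<omega> assume all: "\<omega> \<in> (\<Inter>N. V N)"
    then have sp: "\<omega> \<in> space M" by (auto simp: V_def E_def)
    show "\<omega> \<in> Rec"
    proof (rule ccontr)
      assume "\<omega> \<notin> Rec"
      then have fin: "finite {i. X i \<omega> = 0}" using sp by (simp add: Rec_def INFM_iff_infinite)
      have "count_list (hist X t \<omega>) 0 \<le> card {i. X i \<omega> = 0}" for t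
        unfolding count_list_eq_length_filter length_filter_hist by (intro card_mono fin) auto
      moreover have "\<omega> \<in> V (Suc (card {i. X i \<omega> = 0}))" using all by blast
      then obtain t where "Suc (card {i. X i \<omega> = 0}) \<le> count_list (hist X t \<omega>) 0"
        by (auto simp: V_def E_def)
      ultimately show False by (meson Suc_n_not_le_n order_trans)
    qed
  next
    fix \<omega> N assume "\<omega> \<in> Rec"
    then have sp: "\<omega> \<in> space M" and io: "\<exists>\<^sub>\<infinity>i. X i \<omega> = 0" by (auto simp: Rec_def)
    obtain t where "N \<le> count_list (hist X t \<omega>) 0"
      using count_list_hist_unbounded[where X = X and \<omega> = \<omega> and x = 0 and K = N] io by blast
    then show "\<omega> \<in> V N" using sp by (auto simp: V_def E_def)
  qed
  moreover have "(\<lambda>N. prob (V N)) \<longlonglongrightarrow> prob (\<Inter>N. V N)"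
    using V_sets by (intro finite_Lim_measure_decseq) (auto simp: decseq_def V_def E_def intro: order_trans)
  ultimately have "(\<lambda>N. prob (V N)) \<longlonglongrightarrow> \<rho>" by (simp add: \<rho>_def)
  \<comment> \<open>The margin is half of the mass \<open>\<kappa> * (\<rho> / 2)\<close> that
    escape produces below.\<close>
  then have "eventually (\<lambda>N. prob (V N) < \<rho> + \<kappa> * \<rho> / 4) sequentially"
    using \<kappa> \<rho> by (intro order_tendstoD) auto
  then obtain N where N: "prob (V N) < \<rho> + \<kappa> * \<rho> / 4"
    by (auto dest: eventually_happens)
  have "(\<lambda>t. prob (E N t)) \<longlonglongrightarrow> prob (V N)"
    unfolding V_def using E_sets
    by (intro finite_Lim_measure_incseq) (auto simp: incseq_def E_def intro: order_trans count_list_hist_mono)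
  then have "eventually (\<lambda>t. prob (V N) - \<rho> / 4 < prob (E N t)) sequentially"
    using \<rho> by (intro order_tendstoD) auto
  then obtain m where m: "prob (V N) - \<rho> / 4 < prob (E N m)"
    by (auto dest: eventually_happens)
  have RecV: "Rec \<subseteq> V N" using \<open>(\<Inter>N. V N) = Rec\<close> by blast
  \<comment> \<open>A level that the first \<open>m\<close> steps cannot reach.\<close>
  define n where "n = int m + 1"
  \<comment> \<open>Histories at the hitting time of \<open>n\<close>. Lists are newest first, so
    \<open>drop\<close> recovers the history at time \<open>m\<close>.\<close>
  define S where "S = {a. a \<noteq> [] \<and> hd a = n \<and> n \<notin> set (tl a) \<and> set a \<subseteq> {..n} \<and>
    count_list a (n - 1) \<le> K \<and> m < length a \<and> N \<le> count_list (drop (length a - Suc m) a) 0}"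
  define Cyl where "Cyl a = {\<omega> \<in> space M. hist X (length a - 1) \<omega> = a}" for a
  define Esc where "Esc a = {\<omega> \<in> space M. hist X (length a - 1) \<omega> = a \<and> (\<forall>i\<ge>length a. X i \<omega> > n)}" for a
  have Cyl_sets: "Cyl a \<in> sets M" for a unfolding Cyl_def by (rule sets_hist)
  have Esc_sets: "Esc a \<in> sets M" for a
  proof -
    note [measurable] = pred_hist[of "\<lambda>h. h = a"]
    show ?thesis unfolding Esc_def by measurable
  qed
  have DC: "Esc a \<subseteq> Cyl a" for a by (auto simp: Cyl_def Esc_def)
  have disjC: "disjoint_family_on Cyl S"
  proof -
    \<comment> \<open>In a history from \<open>S\<close>, \<open>n\<close> occurs only as the newest
      entry, so the hitting time on a trajectory determines the history.\<close>
    have "\<not> length a < length b" if "a \<in> S" "b \<in> S" "\<omega> \<in> Cyl a" "\<omega> \<in> Cyl b" for a b \<omega>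
    proof
      assume "length a < length b"
      moreover have "X (length a - 1) \<omega> = n" using that(1,3) by (auto simp: Cyl_def S_def simp flip: hd_hist)
      moreover have "length a \<ge> 1" using that(1) by (cases a) (auto simp: S_def)
      ultimately have "n \<in> set (tl (hist X (length b - 1) \<omega>))" by (force simp: set_tl_hist)
      then show False using that(2,4) by (auto simp: Cyl_def S_def)
    qed
    then have "length a = length b" if "a \<in> S" "b \<in> S" "\<omega> \<in> Cyl a" "\<omega> \<in> Cyl b" for a b \<omega>
      using that by (meson linorder_neqE_nat)
    then show ?thesis unfolding disjoint_family_on_def by (force simp: Cyl_def)
  qed
  then have disjD: "disjoint_family_on Esc S" using DC unfolding disjoint_family_on_def by blast
  have lower: "\<kappa> * prob (\<Union>a\<in>S. Cyl a) \<le> prob (\<Union>a\<in>S. Esc a)"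
  proof -
    have one: "ennreal \<kappa> * emeasure M (Cyl a) \<le> emeasure M (Esc a)" if a: "a \<in> S" for a
    proof -
      have "count_list a n \<le> 1" using a by (intro count_list_one_if_notin_tl) (simp add: S_def)
      then have "\<kappa> * path_wt w a \<le> prob (Esc a)"
        unfolding Esc_def using a by (intro escape) (auto simp: S_def)
      moreover have "prob (Cyl a) = path_wt w a"
        unfolding Cyl_def using a by (intro prob_hist) (auto simp: S_def)
      ultimately show ?thesis using \<kappa> path_wt_nonneg[of a]
        by (simp add: emeasure_eq_measure flip: ennreal_mult)
    qed
    have "ennreal \<kappa> * emeasure M (\<Union>a\<in>S. Cyl a) = (\<integral>\<^sup>+ a. ennreal \<kappa> * emeasure M (Cyl a) \<partial>count_space S)"
      using Cyl_sets disjC by (subst emeasure_UN_countable) (auto simp: nn_integral_cmult)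
    also have "\<dots> \<le> (\<integral>\<^sup>+ a. emeasure M (Esc a) \<partial>count_space S)"
      using one by (intro nn_integral_mono) simp
    also have "\<dots> = emeasure M (\<Union>a\<in>S. Esc a)"
      using Esc_sets disjD by (subst emeasure_UN_countable) auto
    finally show ?thesis using \<kappa> by (simp add: emeasure_eq_measure flip: ennreal_mult)
  qed
  have UC_sets: "(\<Union>a\<in>S. Cyl a) \<in> sets M"
    using Cyl_sets by (intro sets.countable_UN') auto
  \<comment> \<open>An escaping path keeps its \<open>N\<close> early visits to 0 but afterwards
    stays above \<open>n\<close>, hence never returns to 0.\<close>
  have "(\<Union>a\<in>S. Esc a) \<subseteq> V N - Rec"
  proof safe
    fix \<omega> a assume a: "a \<in> S" and D: "\<omega> \<in> Esc a"
    have "drop (length a - 1 - m) (hist X (length a - 1) \<omega>) = hist X m \<omega>"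
      using a by (intro drop_hist) (auto simp: S_def)
    then have "N \<le> count_list (hist X m \<omega>) 0" using a D by (auto simp: S_def Esc_def)
    then show "\<omega> \<in> V N" using D by (auto simp: V_def E_def Esc_def)
    assume "\<omega> \<in> Rec"
    then obtain i where "i > length a" "X i \<omega> = 0" unfolding Rec_def INFM_nat by blast
    moreover have "\<forall>i\<ge>length a. int m + 1 < X i \<omega>" using D by (simp add: Esc_def n_def)
    ultimately have "int m + 1 < 0" by (metis less_imp_le)
    then show False by simp
  qed
  then have "prob (\<Union>a\<in>S. Esc a) \<le> prob (V N - Rec)"
    using V_sets Rec_sets by (intro finite_measure_mono) auto
  also have "\<dots> = prob (V N) - \<rho>"
    unfolding \<rho>_def using V_sets Rec_sets RecV by (intro finite_measure_Diff) auto
  finally have upper: "prob (\<Union>a\<in>S. Esc a) < \<kappa> * \<rho> / 4" using N by linarith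
  define T where "T = {\<omega> \<in> space M. \<exists>t. K \<le> count_list (trunc n (hist X t \<omega>)) (n - int 1)}"
  have T_sets: "T \<in> sets M" unfolding T_def by (intro sets.sets_Collect_countable_Ex sets_hist)
  \<comment> \<open>Almost surely a path in \<open>Rec\<close> hits \<open>n\<close>. Its history
    then lies in \<open>S\<close>, unless it has fewer than \<open>N\<close> visits to 0 by time
    \<open>m\<close> or a large local time at \<open>n - 1\<close>.\<close>
  have "prob Rec \<le> prob ((\<Union>a\<in>S. Cyl a) \<union> (V N - E N m) \<union> T)"
  proof (rule finite_measure_mono_AE)
    from AE_io_all_or_none AE_hist_paths AE_nearest_neighbour
    show "AE \<omega> in M. \<omega> \<in> Rec \<longrightarrow> \<omega> \<in> (\<Union>a\<in>S. Cyl a) \<union> (V N - E N m) \<union> T"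
    proof (eventually_elim, intro impI)
      fix \<omega> assume io: "(\<exists>x. \<exists>\<^sub>\<infinity>i. X i \<omega> = x) \<longrightarrow> (\<forall>y. \<exists>\<^sub>\<infinity>i. X i \<omega> = y)"
        and paths: "\<forall>t. hist X t \<omega> \<in> paths t"
        and nn: "X 0 \<omega> = 0 \<and> (\<forall>i. \<bar>X (Suc i) \<omega> - X i \<omega>\<bar> \<le> 1)"
        and R: "\<omega> \<in> Rec"
      show "\<omega> \<in> (\<Union>a\<in>S. Cyl a) \<union> (V N - E N m) \<union> T"
      proof (rule ccontr)
        assume neg: "\<not> ?thesis"
        have sp: "\<omega> \<in> space M" using R by (simp add: Rec_def)
        have E: "\<omega> \<in> E N m" using neg R RecV by blast
        have nT: "\<not> K \<le> count_list (trunc n (hist X t \<omega>)) (n - int 1)" for t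
          using neg sp by (auto simp: T_def)
        have "\<exists>\<^sub>\<infinity>i. X i \<omega> = n" using io R unfolding Rec_def by blast
        then have ex: "\<exists>i. X i \<omega> = n" by (rule INFM_EX)
        define \<tau> where "\<tau> = (LEAST i. X i \<omega> = n)"
        have X\<tau>: "X \<tau> \<omega> = n" unfolding \<tau>_def using ex by (rule LeastI_ex)
        have min: "X i \<omega> \<noteq> n" if "i < \<tau>" for i using that not_less_Least unfolding \<tau>_def by blast
        have "X \<tau> \<omega> \<in> {- int \<tau>..int \<tau>}"
          using paths_bounded[of "hist X \<tau> \<omega>" \<tau>] paths by (auto simp: set_hist)
        then have m\<tau>: "m < \<tau>" using X\<tau> by (simp add: n_def)
        have le: "X i \<omega> \<le> n" if "i \<le> \<tau>" for i
        proof (rule ccontr)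
          assume "\<not> X i \<omega> \<le> n"
          then have i: "n < X i \<omega>" "i < \<tau>" using that X\<tau> by (auto simp: le_less)
          have "\<exists>k\<ge>0. k \<le> i \<and> X k \<omega> = n"
            using nn i by (intro nat_intermed_int_val) (auto simp: n_def)
          then obtain k where k: "k \<le> i" "X k \<omega> = n" by blast
          have "k < \<tau>" using k(1) i(2) by simp
          then show False using min k(2) by blast
        qed
        define a where "a = hist X \<tau> \<omega>"
        have tl: "n \<notin> set (tl a)" using min by (auto simp: a_def set_tl_hist)
        have "trunc n a = a"
        proof -
          obtain k where k: "\<tau> = Suc k" using m\<tau> by (cases \<tau>) auto
          then show ?thesis using tl by (simp add: a_def)
        qed
        then have "count_list a (n - 1) \<le> K" using nT[of \<tau>] by (simp add: a_def)
        moreover have "drop (length a - Suc m) a = hist X m \<omega>"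
          using drop_hist[of m \<tau> X \<omega>] m\<tau> by (simp add: a_def)
        ultimately have "a \<in> S"
          using E m\<tau> X\<tau> tl le by (auto simp: S_def E_def a_def set_hist)
        moreover have "\<omega> \<in> Cyl a" using sp by (simp add: Cyl_def a_def)
        ultimately show False using neg by blast
      qed
    qed
  qed (use UC_sets V_sets E_sets T_sets in auto)
  also have "\<dots> \<le> prob (\<Union>a\<in>S. Cyl a) + prob (V N - E N m) + prob T"
    using UC_sets V_sets E_sets T_sets
    by (intro order_trans[OF measure_Un_le] add_mono order_refl) auto
  also have "prob (V N - E N m) = prob (V N) - prob (E N m)"
    using V_sets E_sets by (intro finite_measure_Diff) (auto simp: V_def)
  also have "prob T \<le> \<rho> / 4" unfolding T_def by (rule K)
  \<comment> \<open>Each of the two exceptional events costs at most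
    \<open>\<rho> / 4\<close>.\<close>
  finally have "\<rho> / 2 \<le> prob (\<Union>a\<in>S. Cyl a)" using m by (simp add: \<rho>_def)
  then have "\<kappa> * (\<rho> / 2) \<le> \<kappa> * prob (\<Union>a\<in>S. Cyl a)" using \<kappa> by (intro mult_left_mono) auto
  moreover have "0 < \<kappa> * \<rho>" using \<kappa> \<rho> by simp
  ultimately show False using lower upper by simp
qed

end

theorem theorem1p1:
  fixes M :: "'a measure" and X :: "nat \<Rightarrow> 'a \<Rightarrow> int" and w :: "nat \<Rightarrow> real"
  assumes w_pos: "\<And>k. w k > 0"
    and w_asymp: "\<exists>\<alpha> c C. 0 \<le> \<alpha> \<and> \<alpha> < 1/2 \<and> 0 < c \<and> 0 < C \<and>
                  (\<forall>k. c \<le> w k / (real k + 1) powr \<alpha> \<and> w k / (real k + 1) powr \<alpha> \<le> C)"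
    and vrrw: "is_vrrw M X w"
  shows "(AE \<omega> in M. \<forall>y::int. \<exists>\<^sub>\<infinity>n. X n \<omega> = y) \<or>
         (AE \<omega> in M. \<forall>y::int. finite {n. X n \<omega> = y})"
proof -
  obtain \<alpha> c C where *: "0 \<le> \<alpha>" "\<alpha> < 1/2" "0 < c" "0 < C"
    "\<And>k. c \<le> w k / (real k + 1) powr \<alpha>" "\<And>k. w k / (real k + 1) powr \<alpha> \<le> C"
    using w_asymp by blast
  interpret vrrw w \<alpha> c C M X
  proof
    fix k
    have pos: "0 < (real k + 1) powr \<alpha>" by simp
    show "c * (real k + 1) powr \<alpha> \<le> w k" using *(5)[of k] pos by (simp only: pos_le_divide_eq)
    show "w k \<le> C * (real k + 1) powr \<alpha>" using *(6)[of k] pos by (simp only: pos_divide_le_eq)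
  qed (use w_pos * vrrw in auto)
  interpret R: vrrw w \<alpha> c C M "\<lambda>n \<omega>. - X n \<omega>" by (rule vrrw_reflected)
  show ?thesis
  proof (cases "AE \<omega> in M. \<not> (\<exists>\<^sub>\<infinity>i. X i \<omega> = 0)")
    case True
    with AE_io_all_or_none have "AE \<omega> in M. \<forall>y::int. finite {n. X n \<omega> = y}"
      by eventually_elim (auto simp: INFM_iff_infinite)
    then show ?thesis ..
  next
    case False
    \<comment> \<open>Infinitely many returns to 0 now have positive probability, so escape to
      either side is null. Hence almost surely some site, and then every site, is visited infinitely
      often.\<close>
    have "AE \<omega> in M. \<not> (\<forall>k. \<exists>m. \<forall>i\<ge>m. X i \<omega> > k)"
      using AE_not_io_if_escape_possible False by blast
    moreover have "AE \<omega> in M. \<not> (\<forall>k. \<exists>m. \<forall>i\<ge>m. - X i \<omega> > k)"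
      using R.AE_not_io_if_escape_possible False by auto
    ultimately have "AE \<omega> in M. \<forall>y::int. \<exists>\<^sub>\<infinity>n. X n \<omega> = y"
      using AE_io_all_or_none AE_nearest_neighbour
    proof eventually_elim
      case (elim \<omega>)
      then have "\<exists>x. infinite {i. X i \<omega> = x}"
        using eventually_one_sided_if_no_site_io[of "\<lambda>i. X i \<omega>"] by blast
      with elim show ?case unfolding INFM_iff_infinite by blast
    qed
    then show ?thesis ..
  qed
qed

end
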